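(* Let $\alpha$ be a continuous rotationally symmetric norm on $L^\infty(\mathbb T)$ and let $X$ be a separable Banach space. Then: (1) If $F\in L^\alpha(\mathbb T,X)$, then $\alpha(F-\sigma_n(F))\to0$ as $n\to\infty$; hence $L^\alpha(\mathbb T,X)$ is the $\alpha$-closed linear span of $\{x\cdot z^n:x\in X,\ n\in\mathbb Z\}$. (2) If $F\in H^\alpha(\mathbb T,X)$, then $S_n(F)=\sum_{k=0}^n\hat F(k)z^k$; hence $H^\alpha(\mathbb T,X)$ is the $\alpha$-closed linear span of $\{x\cdot z^n:x\in X,\ n\ge0\}$.
   Context: $\mathbb T$ is the unit circle and $m$ is normalized arc length (Haar measure) on $\mathbb T$; functions equal a.e. are identified. For $w\in\mathbb T$, $f_w(z)=f(\overline wz)$. A continuous rotationally symmetric norm is a norm $\alpha$ on $L^\infty(\mathbb T)$ with $\alpha(1)=1$, $\alpha(|f|)=\alpha(f)$, $\alpha(f_w)=\alpha(f)$ for all $f\in L^\infty(\mathbb T)$, $w\in\mathbb T$, and $\lim_{m(E)\to0^+}\alpha(\chi_E)=0$. For any measurable $f:\mathbb T\to\mathbb C$ put $\alpha(f)=\sup\{\alpha(s):s\text{ a simple function},\ |s|\le|f|\}$. $\mathcal L^\alpha(\mathbb T)$ is the set of measurable $f$ with $\alpha(f)<\infty$, and $L^\alpha(\mathbb T)$ is the $\alpha$-closure of $L^\infty(\mathbb T)$ in $\mathcal L^\alpha(\mathbb T)$. For $f:\mathbb T\to X$ measurable, $|f|(z)=\|f(z)\|$ and $\alpha(f)=\alpha(|f|)$;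 $L^\alpha(\mathbb T,X)$ is the space (with norm $\alpha$) of measurable $f:\mathbb T\to X$ with $|f|\in L^\alpha(\mathbb T)$. For $F\in L^1(\mathbb T,X)$: $\hat F(n)=\int_{\mathbb T}F(z)z^{-n}\,dm(z)\in X$ (Bochner integral), $S_n(F)(z)=\sum_{k=-n}^n\hat F(k)z^k$, and $\sigma_n(F)=\frac1{n+1}\sum_{k=0}^nS_k(F)$. $H^\alpha(\mathbb T,X)=\{F\in L^\alpha(\mathbb T,X):\hat F(n)=0\text{ for all }n<0\}$. *)

theory Defs
  imports "HOL-Analysis.Analysis" "HOL-Library.Function_Algebras"
begin

section \<open>Complex Banach spaces\<close>

class scaleC =
  fixes scaleC :: "complex \<Rightarrow> 'a \<Rightarrow> 'a"  (infixr "*\<^sub>C" 75)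

class complex_banach = banach + scaleC +
  assumes scaleR_scaleC: "r *\<^sub>R x = complex_of_real r *\<^sub>C x"
    and scaleC_add_right: "a *\<^sub>C (x + y) = a *\<^sub>C x + a *\<^sub>C y"
    and scaleC_add_left: "(a + b) *\<^sub>C x = a *\<^sub>C x + b *\<^sub>C x"
    and scaleC_scaleC: "a *\<^sub>C (b *\<^sub>C x) = (a * b) *\<^sub>C x"
    and norm_scaleC: "norm (a *\<^sub>C x) = cmod a * norm x"

instantiation complex :: complex_banach
begin

definition scaleC_complex :: "complex \<Rightarrow> complex \<Rightarrow> complex" where
  "scaleC_complex a x = a * x"

instance
  by standard (simp_all add: scaleC_complex_def scaleR_conv_of_real norm_mult algebra_simps)

end

section \<open>The circle with normalized arc length\<close>

text \<open>The Borel sets of the circle suffice: functions are identified almost everywhere, and every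
  Lebesgue measurable function into a separable metric space agrees almost everywhere with a Borel
  measurable one. Functions on the circle are total functions on the complex plane whose values off
  the unit circle are irrelevant.\<close>

definition circle :: "complex measure" where
  "circle = distr (restrict_space lborel {0..1::real}) (restrict_space borel (sphere 0 1))
              (\<lambda>t. cis (2 * pi * t))"

lemma space_circle [simp]: "space circle = sphere 0 1"
  by (simp add: circle_def space_restrict_space)

lemma sets_circle: "sets circle = sets (restrict_space borel (sphere 0 1))"
  by (simp add: circle_def)

lemma emeasure_circle_space: "emeasure circle (sphere 0 1) = 1"
proof -
  have "continuous_on UNIV (\<lambda>t::real. cis (2 * pi * t))"
    by (intro continuous_intros)
  then have "(\<lambda>t. cis (2 * pi * t)) \<in> borel_measurable lborel"
    by (simp add: borel_measurable_continuous_onI)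
  then have m: "(\<lambda>t. cis (2 * pi * t)) \<in>
      measurable (restrict_space lborel {0..1::real}) (restrict_space borel (sphere 0 1))"
    by (intro measurable_restrict_space2 measurable_restrict_space1) auto
  have "(\<lambda>t. cis (2 * pi * t)) -` sphere 0 1 \<inter> space (restrict_space lborel {0..1}) = {0..1::real}"
    by (simp add: space_restrict_space set_eq_iff)
  moreover have "sphere 0 1 \<in> sets (restrict_space borel (sphere (0::complex) 1))"
    using sets.top[of "restrict_space borel (sphere (0::complex) 1)"]
    by (simp add: space_restrict_space)
  ultimately have "emeasure circle (sphere 0 1) = emeasure (restrict_space lborel {0..1::real}) {0..1}"
    unfolding circle_def using emeasure_distr[OF m] by simp
  then show ?thesis
    by (simp add: emeasure_restrict_space)
qed

section \<open>Continuous rotationally symmetric norms\<close>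

definition Linf :: "(complex \<Rightarrow> complex) set" where
  "Linf = {f \<in> borel_measurable circle. \<exists>C. AE z in circle. cmod (f z) \<le> C}"

text \<open>The axioms \<open>zero_iff\<close> and \<open>triangle\<close> imply that \<open>\<alpha>\<close> takes equal values on functions of \<open>Linf\<close> that
  agree almost everywhere, so \<open>\<alpha>\<close> is a norm on the space of equivalence classes.\<close>

locale continuous_rot_sym_norm =
  fixes \<alpha> :: "(complex \<Rightarrow> complex) \<Rightarrow> real"
  assumes nonneg: "f \<in> Linf \<Longrightarrow> 0 \<le> \<alpha> f"
    and zero_iff: "f \<in> Linf \<Longrightarrow> \<alpha> f = 0 \<longleftrightarrow> (AE z in circle. f z = 0)"
    and scale: "f \<in> Linf \<Longrightarrow> \<alpha> (\<lambda>z. c * f z) = cmod c * \<alpha> f"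
    and triangle: "f \<in> Linf \<Longrightarrow> g \<in> Linf \<Longrightarrow> \<alpha> (\<lambda>z. f z + g z) \<le> \<alpha> f + \<alpha> g"
    and normalized: "\<alpha> (\<lambda>z. 1) = 1"
    and modulus: "f \<in> Linf \<Longrightarrow> \<alpha> (\<lambda>z. complex_of_real (cmod (f z))) = \<alpha> f"
    and rotation: "f \<in> Linf \<Longrightarrow> w \<in> sphere 0 1 \<Longrightarrow> \<alpha> (\<lambda>z. f (cnj w * z)) = \<alpha> f"
    and continuity: "\<forall>\<epsilon>>0. \<exists>\<delta>>0. \<forall>E\<in>sets circle.
          0 < measure circle E \<and> measure circle E < \<delta> \<longrightarrow> \<alpha> (indicator E) < \<epsilon>"

section \<open>The extended norm and the associated spaces\<close>

definition ext_norm :: "((complex \<Rightarrow> complex) \<Rightarrow> real) \<Rightarrow> (complex \<Rightarrow> complex) \<Rightarrow> ennreal" where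
  "ext_norm \<alpha> f = (SUP s\<in>{s. simple_function circle s \<and> (AE z in circle. cmod (s z) \<le> cmod (f z))}.
                     ennreal (\<alpha> s))"

definition norm_fun :: "(complex \<Rightarrow> 'x::real_normed_vector) \<Rightarrow> complex \<Rightarrow> complex" where
  "norm_fun F = (\<lambda>z. complex_of_real (norm (F z)))"

definition vec_norm ::
    "((complex \<Rightarrow> complex) \<Rightarrow> real) \<Rightarrow> (complex \<Rightarrow> 'x::real_normed_vector) \<Rightarrow> ennreal" where
  "vec_norm \<alpha> F = ext_norm \<alpha> (norm_fun F)"

text \<open>\<open>closure_wrt N A S\<close> is the \<open>N\<close>-closure of \<open>S\<close> in \<open>A\<close>.\<close>

definition closure_wrt ::
    "((complex \<Rightarrow> 'x::real_normed_vector) \<Rightarrow> ennreal) \<Rightarrow> (complex \<Rightarrow> 'x) set \<Rightarrow> (complex \<Rightarrow> 'x) set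
      \<Rightarrow> (complex \<Rightarrow> 'x) set" where
  "closure_wrt N A S = {F \<in> A. \<forall>\<epsilon>>0. \<exists>G\<in>S. N (\<lambda>z. F z - G z) < \<epsilon>}"

definition calL :: "((complex \<Rightarrow> complex) \<Rightarrow> real) \<Rightarrow> (complex \<Rightarrow> complex) set" where
  "calL \<alpha> = {f \<in> borel_measurable circle. ext_norm \<alpha> f < \<infinity>}"

definition Lalpha :: "((complex \<Rightarrow> complex) \<Rightarrow> real) \<Rightarrow> (complex \<Rightarrow> complex) set" where
  "Lalpha \<alpha> = closure_wrt (ext_norm \<alpha>) (calL \<alpha>) Linf"

definition calL_vec ::
    "((complex \<Rightarrow> complex) \<Rightarrow> real) \<Rightarrow> (complex \<Rightarrow> 'x::real_normed_vector) set" where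
  "calL_vec \<alpha> = {F \<in> borel_measurable circle. vec_norm \<alpha> F < \<infinity>}"

definition Lalpha_vec ::
    "((complex \<Rightarrow> complex) \<Rightarrow> real) \<Rightarrow> (complex \<Rightarrow> 'x::real_normed_vector) set" where
  "Lalpha_vec \<alpha> = {F \<in> borel_measurable circle. norm_fun F \<in> Lalpha \<alpha>}"

section \<open>Fourier coefficients, partial sums and Cesaro means\<close>

text \<open>The class \<open>second_countable_topology\<close> expresses separability of the Banach space.
  The coefficients are meaningful for integrable functions, in particular for the elements of
  \<open>Lalpha_vec \<alpha>\<close>, since \<open>\<alpha>\<close> dominates the \<open>L\<^sup>1\<close> norm.\<close>

definition fourier_coeff ::
    "(complex \<Rightarrow> 'x::{complex_banach,second_countable_topology}) \<Rightarrow> int \<Rightarrow> 'x" where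
  "fourier_coeff F n = (\<integral>z. (z powi (- n)) *\<^sub>C F z \<partial>circle)"

definition fourier_sum ::
    "nat \<Rightarrow> (complex \<Rightarrow> 'x::{complex_banach,second_countable_topology}) \<Rightarrow> complex \<Rightarrow> 'x" where
  "fourier_sum n F z = (\<Sum>k\<in>{- int n..int n}. (z powi k) *\<^sub>C fourier_coeff F k)"

definition cesaro_mean ::
    "nat \<Rightarrow> (complex \<Rightarrow> 'x::{complex_banach,second_countable_topology}) \<Rightarrow> complex \<Rightarrow> 'x" where
  "cesaro_mean n F z = (1 / real (n + 1)) *\<^sub>R (\<Sum>k=0..n. fourier_sum k F z)"

definition Halpha_vec ::
    "((complex \<Rightarrow> complex) \<Rightarrow> real)
      \<Rightarrow> (complex \<Rightarrow> 'x::{complex_banach,second_countable_topology}) set" where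
  "Halpha_vec \<alpha> = {F \<in> Lalpha_vec \<alpha>. \<forall>n<0. fourier_coeff F n = 0}"

section \<open>Closed linear spans\<close>

text \<open>The linear span is taken over the complex numbers, and its closure in all of \<open>calL_vec \<alpha>\<close> rather
  than in \<open>Lalpha_vec \<alpha>\<close>. If the space described as a closed linear span is itself closed, the
  two closures agree.\<close>

definition closed_linear_span ::
    "((complex \<Rightarrow> complex) \<Rightarrow> real) \<Rightarrow> (complex \<Rightarrow> 'x::complex_banach) set \<Rightarrow> (complex \<Rightarrow> 'x) set" where
  "closed_linear_span \<alpha> B =
     closure_wrt (vec_norm \<alpha>) (calL_vec \<alpha>) (module.span (\<lambda>c F z. c *\<^sub>C F z) B)"

lemma module_scaleC_fun: "module (\<lambda>c (F :: complex \<Rightarrow> 'x::complex_banach) z. c *\<^sub>C F z)"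
proof (rule module.intro)
  have one: "1 *\<^sub>C x = x" for x :: 'x
    using scaleR_scaleC[of 1 x] by simp
  show "(\<lambda>z. 1 *\<^sub>C F z) = F" for F :: "complex \<Rightarrow> 'x"
    by (simp add: one)
qed (simp_all add: plus_fun_def scaleC_add_right scaleC_add_left scaleC_scaleC)

end

theory Submission
  imports Defs
begin

text \<open>
  The Fejer kernel \<open>K\<^sub>n\<close> is a nonnegative trigonometric polynomial, so on a trigonometric polynomial
  \<open>P\<close> the convolution \<open>\<sigma>\<^sub>n P\<close> is given exactly by a quadrature over the \<open>M\<close>-th roots of unity for large \<open>M\<close>:
  \<open>\<sigma>\<^sub>n P\<close> is a convex combination of rotations of \<open>P\<close>. The triangle inequality and rotation invariance
  then give \<open>\<alpha>(\<sigma>\<^sub>n P) \<le> \<alpha>(P)\<close> without any Minkowski inequality for integrals; the case \<open>n = 0\<close> reads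
  \<open>|\<integral>P| \<le> \<alpha>(P)\<close>. Continuity of \<open>\<alpha>\<close> makes trigonometric polynomials dense in \<open>L\<^sup>\<alpha>\<close>, hence \<open>\<alpha>\<close> dominates
  the \<open>L\<^sup>1\<close> norm, the contraction estimate extends to all of \<open>L\<^sup>\<alpha>\<close>, and both the convergence
  \<open>\<sigma>\<^sub>n F \<rightarrow> F\<close> and the closedness of \<open>H\<^sup>\<alpha>\<close> follow.
\<close>

section \<open>Scalar multiplication and the circle\<close>

text \<open>The axioms mention no integral, and even monotonicity of \<alpha> in |f| has to be
  derived. Fourier coefficients of F in L^\<alpha> make sense only once \<alpha> is known to
  dominate the L1 norm, so Cesaro means are not yet available for proving density. Density comes
  instead from regularity of arc length, Urysohn functions and Stone-Weierstrass, and it is measured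
  in \<alpha> and in L1 at once, because |\<integral>P| \<le> \<alpha>(P) passes to a limit only if
  both sides converge. The contraction extends to L^\<alpha> because, for fixed n, \<sigma>_n maps
  L1 into the bounded functions with constant 2n+1; this is crude but enough when the approximation
  of F may depend on n. The definitions add two tasks. The extended norm is a supremum over simple
  functions only, so its agreement with \<alpha> on bounded functions and its triangle inequality
  need an argument. And L^\<alpha>(T,X) is defined through |F| alone, so a scalar approximation of
  |F| must be turned into a vector-valued approximation of F.\<close>

lemma bounded_bilinear_scaleC:
  "bounded_bilinear (scaleC :: complex \<Rightarrow> 'a::complex_banach \<Rightarrow> 'a)"
proof
  show "\<exists>K. \<forall>a x. norm (a *\<^sub>C (x::'a)) \<le> norm a * norm x * K"
    by (rule exI[of _ 1]) (simp add: norm_scaleC)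
qed (simp_all add: scaleC_add_right scaleC_add_left scaleR_scaleC scaleC_scaleC
      scaleC_complex_def mult.commute)

interpretation scaleC: bounded_bilinear "scaleC :: complex \<Rightarrow> 'a::complex_banach \<Rightarrow> 'a"
  by (rule bounded_bilinear_scaleC)

lemma borel_measurable_scaleC [measurable (raw)]:
  fixes g :: "'b \<Rightarrow> 'a::{complex_banach,second_countable_topology}"
  assumes "f \<in> borel_measurable M" "g \<in> borel_measurable M"
  shows "(\<lambda>z. f z *\<^sub>C g z) \<in> borel_measurable M"
  by (rule borel_measurable_continuous_Pair[OF assms]) (intro scaleC.continuous_on continuous_intros)

interpretation circle: finite_measure circle
  by standard (simp add: emeasure_circle_space)

lemma measure_circle_sphere [simp]: "measure circle (sphere 0 1) = 1"
  by (simp add: measure_def emeasure_circle_space)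

lemma measurable_circle_continuous:
  assumes "continuous_on (sphere 0 1) f"
  shows "f \<in> borel_measurable circle"
  using borel_measurable_continuous_on_restrict[OF assms]
    measurable_cong_sets[OF sets_circle refl, of borel] by metis

lemma measurable_powi [measurable]: "(\<lambda>z::complex. z powi k) \<in> borel_measurable circle"
  by (intro measurable_circle_continuous continuous_intros) auto

lemma measurable_rotate_circle:
  assumes "w \<in> sphere 0 1"
  shows "(\<lambda>z. w * z) \<in> measurable circle circle"
  unfolding measurable_cong_sets[OF sets_circle sets_circle]
  by (rule measurable_restrict_space3) (use assms in \<open>auto simp: norm_mult\<close>)

lemma measurable_param_circle:
  "(\<lambda>t. cis (2 * pi * t)) \<in>
     measurable (restrict_space lborel {0..1::real}) (restrict_space borel (sphere 0 1))"
proof -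
  have "(\<lambda>t::real. cis (2 * pi * t)) \<in> borel_measurable lborel"
    by (simp, intro borel_measurable_continuous_onI continuous_intros)
  then show ?thesis
    by (intro measurable_restrict_space2 measurable_restrict_space1) auto
qed

lemma integral_powi_circle: "(\<integral>z. z powi k \<partial>circle) = (if k = 0 then 1 else 0)"
proof (cases "k = 0")
  case True
  then show ?thesis by simp
next
  case False
  \<comment> \<open>An antiderivative of the integrand; it has period 1 because k is an integer, so
    the integral vanishes.\<close>
  define F where "F t = cis (2 * pi * k * t) / (2 * pi * \<i> * k)" for t :: real
  have c: "cis (2 * pi * t) powi k = cis (2 * pi * k * t)" for t :: real
    by (simp add: cis_power_int mult_ac)
  have "(\<integral>z. z powi k \<partial>circle) = (\<integral>t. cis (2 * pi * t) powi k \<partial>restrict_space lborel {0..1::real})"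
    unfolding circle_def
  proof (rule integral_distr[OF measurable_param_circle])
    show "(\<lambda>z::complex. z powi k) \<in> borel_measurable (restrict_space borel (sphere 0 1))"
      using measurable_powi[of k] measurable_cong_sets[OF sets_circle refl, of borel] by metis
  qed
  also have "\<dots> = (\<integral>t. indicator {0..1} t *\<^sub>R cis (2 * pi * k * t) \<partial>lborel)"
    by (simp add: c integral_restrict_space)
  also have "\<dots> = F 1 - F 0"
  proof (rule integral_FTC_Icc)
    show "(F has_vector_derivative cis (2 * pi * k * t)) (at t within {0..1})" for t
    proof -
      define c where "c = 2 * pi * \<i> * k"
      have F: "F = (\<lambda>t. exp (t *\<^sub>R c) * (1 / c))"
        by (simp add: F_def c_def cis_conv_exp fun_eq_iff scaleR_conv_of_real mult_ac)
      have "(F has_vector_derivative (exp (t *\<^sub>R c) * c) * (1 / c)) (at t within {0..1})"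
        unfolding F by (intro has_vector_derivative_mult_left exp_scaleR_has_vector_derivative_right)
      also have "(exp (t *\<^sub>R c) * c) * (1 / c) = cis (2 * pi * k * t)"
        using False by (simp add: c_def cis_conv_exp scaleR_conv_of_real mult_ac)
      finally show ?thesis .
    qed
  qed (auto intro!: continuous_intros)
  also have "F 1 = F 0"
    using cis_multiple_2pi[of k] by (simp add: F_def mult_ac)
  finally show ?thesis using False by simp
qed

section \<open>Trigonometric polynomials and their Cesaro means\<close>

text \<open>The predicate on frequencies lets one development serve both spans of the theorem: all
  integers, and n \<ge> 0.\<close>

definition trig_polys :: "(int \<Rightarrow> bool) \<Rightarrow> (complex \<Rightarrow> 'x::complex_banach) set" where
  "trig_polys Q = module.span (\<lambda>c F z. c *\<^sub>C F z) {(\<lambda>z. (z powi n) *\<^sub>C x) |x n. Q n}"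

context
  fixes Q :: "int \<Rightarrow> bool"
begin

lemma trig_polys_monomial: "Q n \<Longrightarrow> (\<lambda>z. (z powi n) *\<^sub>C x) \<in> trig_polys Q"
  unfolding trig_polys_def by (intro module.span_base[OF module_scaleC_fun]) auto

lemma trig_polys_zero: "(\<lambda>z. 0) \<in> trig_polys Q"
  using module.span_zero[OF module_scaleC_fun] unfolding trig_polys_def zero_fun_def .

lemma trig_polys_add:
  "F \<in> trig_polys Q \<Longrightarrow> G \<in> trig_polys Q \<Longrightarrow> (\<lambda>z. F z + G z) \<in> trig_polys Q"
  using module.span_add[OF module_scaleC_fun, of F _ G] unfolding trig_polys_def plus_fun_def .

lemma trig_polys_scaleC: "F \<in> trig_polys Q \<Longrightarrow> (\<lambda>z. c *\<^sub>C F z) \<in> trig_polys Q"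
  using module.span_scale[OF module_scaleC_fun, of F _ c] unfolding trig_polys_def .

lemma trig_polys_diff:
  "F \<in> trig_polys Q \<Longrightarrow> G \<in> trig_polys Q \<Longrightarrow> (\<lambda>z. F z - G z) \<in> trig_polys Q"
  using trig_polys_add[of F "\<lambda>z. (-1) *\<^sub>C G z"] trig_polys_scaleC[of G "-1"] scaleR_scaleC[of "-1"]
  by (metis (no_types, lifting) ext diff_conv_add_uminus of_real_1 of_real_minus scaleR_minus1_left)

lemma trig_polys_scaleR: "F \<in> trig_polys Q \<Longrightarrow> (\<lambda>z. c *\<^sub>R F z) \<in> trig_polys Q"
  unfolding scaleR_scaleC by (rule trig_polys_scaleC)

lemma trig_polys_sum:
  "(\<And>i. i \<in> I \<Longrightarrow> F i \<in> trig_polys Q) \<Longrightarrow> (\<lambda>z. \<Sum>i\<in>I. F i z) \<in> trig_polys Q"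
  by (induction I rule: infinite_finite_induct) (auto intro: trig_polys_zero trig_polys_add)

text \<open>The scalar of a linear combination is absorbed into the coefficient x, so the step only
  adds a plain monomial.\<close>

lemma trig_polys_induct [consumes 1, case_names zero add]:
  assumes "F \<in> trig_polys Q"
    and "R (\<lambda>z. 0)"
    and "\<And>n x G. Q n \<Longrightarrow> G \<in> trig_polys Q \<Longrightarrow> R G \<Longrightarrow> R (\<lambda>z. (z powi n) *\<^sub>C x + G z)"
  shows "R F"
proof -
  \<comment> \<open>Membership is carried along because the span induction rule does not supply it
    for the remainder, while the third assumption needs it.\<close>
  have "F \<in> trig_polys Q \<and> R F"
    using assms(1) unfolding trig_polys_def
  proof (induction rule: module.span_induct_alt[OF module_scaleC_fun, consumes 1, case_names base step])
    case base
    then show ?case using assms(2) trig_polys_zero by (simp add: zero_fun_def trig_polys_def)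
  next
    case (step c F G)
    then obtain x n where "Q n" and F: "F = (\<lambda>z. (z powi n) *\<^sub>C x)" by auto
    have *: "(\<lambda>z. c *\<^sub>C F z) + G = (\<lambda>z. (z powi n) *\<^sub>C (c *\<^sub>C x) + G z)"
      by (simp add: F fun_eq_iff scaleC_scaleC mult.commute)
    show ?case unfolding * trig_polys_def[symmetric] using step \<open>Q n\<close>
      by (auto intro!: assms(3) trig_polys_add trig_polys_monomial simp: trig_polys_def[symmetric])
  qed
  then show ?thesis ..
qed

end


lemma trig_polys_mono:
  assumes "F \<in> trig_polys Q" "\<And>n. Q n \<Longrightarrow> Q' n"
  shows "F \<in> trig_polys Q'"
  using assms(1)
proof (induction rule: trig_polys_induct)
  case (add n x G)
  show ?case by (intro trig_polys_add trig_polys_monomial add assms(2))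
qed (rule trig_polys_zero)

lemma trig_polys_measurable:
  fixes F :: "complex \<Rightarrow> 'x::{complex_banach,second_countable_topology}"
  assumes "F \<in> trig_polys Q"
  shows "F \<in> borel_measurable circle"
  using assms by (induction rule: trig_polys_induct) auto

lemma trig_polys_bounded:
  assumes "F \<in> trig_polys Q"
  obtains C where "0 \<le> C" "\<And>z. z \<in> sphere 0 1 \<Longrightarrow> norm (F z) \<le> C"
proof -
  from assms have "\<exists>C\<ge>0. \<forall>z\<in>sphere 0 1. norm (F z) \<le> C"
  proof (induction rule: trig_polys_induct)
    case (add n x G)
    then obtain C where "C \<ge> 0" "\<forall>z\<in>sphere 0 1. norm (G z) \<le> C" by auto
    then have "\<forall>z\<in>sphere 0 1. norm ((z powi n) *\<^sub>C x + G z) \<le> norm x + C"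
      by (auto intro!: norm_triangle_le add_mono simp: norm_scaleC norm_power_int)
    then show ?case using \<open>C \<ge> 0\<close> by (intro exI[of _ "norm x + C"]) auto
  qed auto
  then show ?thesis using that by auto
qed

lemma trig_polys_integrable:
  fixes F :: "complex \<Rightarrow> 'x::{complex_banach,second_countable_topology}"
  assumes "F \<in> trig_polys Q"
  shows "integrable circle F"
proof -
  obtain C where "\<And>z. z \<in> sphere 0 1 \<Longrightarrow> norm (F z) \<le> C"
    using trig_polys_bounded[OF assms] by blast
  then show ?thesis
    by (intro circle.integrable_const_bound[of _ C] trig_polys_measurable[OF assms]) auto
qed

section \<open>Fourier coefficients, partial sums and Cesaro means of integrable functions\<close>

lemma integrable_powi_scaleC:
  fixes F :: "complex \<Rightarrow> 'x::{complex_banach,second_countable_topology}"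
  assumes "integrable circle F"
  shows "integrable circle (\<lambda>z. (z powi k) *\<^sub>C F z)"
  by (rule Bochner_Integration.integrable_bound[OF assms])
     (use assms in \<open>auto simp: norm_scaleC norm_power_int\<close>)

lemma fourier_coeff_add:
  assumes "integrable circle F" "integrable circle G"
  shows "fourier_coeff (\<lambda>z. F z + G z) k = fourier_coeff F k + fourier_coeff G k"
  using assms[THEN integrable_powi_scaleC]
  by (simp add: fourier_coeff_def scaleC_add_right)

lemma fourier_coeff_diff:
  assumes "integrable circle F" "integrable circle G"
  shows "fourier_coeff (\<lambda>z. F z - G z) k = fourier_coeff F k - fourier_coeff G k"
  using assms[THEN integrable_powi_scaleC]
  by (simp add: fourier_coeff_def scaleC.diff_right)

lemma fourier_coeff_monomial:
  "fourier_coeff (\<lambda>z. (z powi n) *\<^sub>C x) k = (if k = n then x else 0)"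
proof -
  \<comment> \<open>The exponent law can fail at z = 0; on the circle that case does not
    occur.\<close>
  have "z powi (- k) * z powi n = z powi (n - k)" if "z \<in> sphere (0::complex) 1" for z
    using that power_int_add[of z "- k" n] by (cases "z = 0") auto
  then have "fourier_coeff (\<lambda>z. (z powi n) *\<^sub>C x) k = (\<integral>z. (z powi (n - k)) *\<^sub>C x \<partial>circle)"
    unfolding fourier_coeff_def scaleC_scaleC
    by (intro Bochner_Integration.integral_cong refl arg_cong[where f = "\<lambda>a. a *\<^sub>C x"]) simp
  also have "\<dots> = (\<integral>z. z powi (n - k) \<partial>circle) *\<^sub>C x"
  proof (rule integral_bounded_linear[OF scaleC.bounded_linear_left])
    have "(\<lambda>z::complex. (z powi (n - k)) *\<^sub>C (1::complex)) \<in> trig_polys (\<lambda>_. True)"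
      by (rule trig_polys_monomial) simp
    then show "integrable circle (\<lambda>z::complex. z powi (n - k))"
      using trig_polys_integrable[of "\<lambda>z::complex. (z powi (n - k)) *\<^sub>C (1::complex)"]
      by (simp add: scaleC_complex_def)
  qed
  finally show ?thesis
    using scaleR_scaleC[of 1 x] by (auto simp: integral_powi_circle scaleC.zero_left)
qed

text \<open>With frequencies n \<ge> 0 this is the vanishing that later passes to \<alpha>-limits
  and shows that H^\<alpha> is closed.\<close>

lemma fourier_coeff_trig_poly:
  assumes "F \<in> trig_polys Q" "\<not> Q k"
  shows "fourier_coeff F k = 0"
  using assms(1)
proof (induction rule: trig_polys_induct)
  case (add n x G)
  then show ?case using assms(2)
    by (subst fourier_coeff_add)
       (auto intro!: trig_polys_integrable trig_polys_monomial simp: fourier_coeff_monomial)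
qed (simp add: fourier_coeff_def scaleC.zero_right)

lemma norm_fourier_coeff_le:
  assumes "integrable circle F"
  shows "norm (fourier_coeff F k) \<le> (\<integral>z. norm (F z) \<partial>circle)"
proof -
  have "norm (fourier_coeff F k) \<le> (\<integral>z. norm ((z powi (- k)) *\<^sub>C F z) \<partial>circle)"
    unfolding fourier_coeff_def by (rule integral_norm_bound)
  also have "\<dots> = (\<integral>z. norm (F z) \<partial>circle)"
    by (intro Bochner_Integration.integral_cong) (auto simp: norm_scaleC norm_power_int)
  finally show ?thesis .
qed

lemma fourier_sum_add:
  assumes "integrable circle F" "integrable circle G"
  shows "fourier_sum n (\<lambda>z. F z + G z) z = fourier_sum n F z + fourier_sum n G z"
  by (simp add: fourier_sum_def fourier_coeff_add[OF assms] scaleC_add_right sum.distrib)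

lemma cesaro_mean_add:
  assumes "integrable circle F" "integrable circle G"
  shows "cesaro_mean n (\<lambda>z. F z + G z) z = cesaro_mean n F z + cesaro_mean n G z"
  by (simp add: cesaro_mean_def fourier_sum_add[OF assms] scaleR_add_right sum.distrib)

lemma cesaro_mean_diff:
  assumes "integrable circle F" "integrable circle G"
  shows "cesaro_mean n (\<lambda>z. F z - G z) z = cesaro_mean n F z - cesaro_mean n G z"
proof -
  \<comment> \<open>Additivity is applied to (F - G) + G.\<close>
  have "integrable circle (\<lambda>z. F z - G z)" using assms by simp
  from cesaro_mean_add[OF this assms(2), of n z] show ?thesis by simp
qed

lemma fourier_sum_monomial:
  "fourier_sum k (\<lambda>z. (z powi m) *\<^sub>C x) z = (if \<bar>m\<bar> \<le> int k then (z powi m) *\<^sub>C x else 0)"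
proof -
  have "fourier_sum k (\<lambda>z. (z powi m) *\<^sub>C x) z
      = (\<Sum>i\<in>{- int k..int k}. if i = m then (z powi m) *\<^sub>C x else 0)"
    unfolding fourier_sum_def by (rule sum.cong) (auto simp: fourier_coeff_monomial scaleC.zero_right)
  then show ?thesis by (auto simp: sum.delta)
qed

text \<open>Two uses: with \<open>Q\<close> always true the hypothesis is vacuous and every Cesaro
  mean is a trigonometric polynomial; with n \<ge> 0 the means of an element of H^\<alpha> are
  analytic polynomials.\<close>

lemma cesaro_mean_in_trig_polys:
  assumes "\<And>k. \<not> Q k \<Longrightarrow> fourier_coeff F k = 0"
  shows "cesaro_mean n F \<in> trig_polys Q"
proof -
  have "(\<lambda>z. (z powi k) *\<^sub>C fourier_coeff F k) \<in> trig_polys Q" for k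
    using assms[of k] trig_polys_zero[of Q]
    by (cases "Q k") (auto intro: trig_polys_monomial simp: scaleC.zero_right)
  then have "(\<lambda>z. cesaro_mean n F z) \<in> trig_polys Q"
    unfolding cesaro_mean_def fourier_sum_def by (intro trig_polys_scaleR trig_polys_sum)
  then show ?thesis by simp
qed

text \<open>Each of the 2k+1 terms of a partial sum is at most the L1 norm. The growth in n is
  harmless: the bound is applied with n fixed.\<close>

lemma cesaro_mean_bound:
  assumes "integrable circle F" "z \<in> sphere 0 1"
  shows "norm (cesaro_mean n F z) \<le> real (2 * n + 1) * (\<integral>z. norm (F z) \<partial>circle)"
proof -
  let ?I = "\<integral>z. norm (F z) \<partial>circle"
  have I: "0 \<le> ?I" by simp
  have "norm (fourier_sum k F z) \<le> real (2 * n + 1) * ?I" if "k \<le> n" for k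
  proof -
    have "norm (fourier_sum k F z) \<le> (\<Sum>i\<in>{- int k..int k}. ?I)"
      unfolding fourier_sum_def using assms
      by (intro sum_norm_le) (simp add: norm_scaleC norm_power_int norm_fourier_coeff_le)
    also have "\<dots> = real (2 * k + 1) * ?I" by (simp add: algebra_simps)
    also have "\<dots> \<le> real (2 * n + 1) * ?I" using that I by (intro mult_right_mono) auto
    finally show ?thesis .
  qed
  then have "norm (\<Sum>k=0..n. fourier_sum k F z) \<le> (\<Sum>k=0..n. real (2 * n + 1) * ?I)"
    by (intro sum_norm_le) auto
  also have "\<dots> = real (n + 1) * (real (2 * n + 1) * ?I)" by simp
  finally show ?thesis
    by (simp add: cesaro_mean_def field_simps)
qed

text \<open>The k-th partial sum of a monomial of frequency m is 0 for k < |m| and the monomial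
  itself afterwards. So at most |m| of the n+1 averaged terms differ from it, and the error is at
  most |m| times the norm of the coefficient, divided by n+1.\<close>

lemma cesaro_mean_trig_poly_error:
  assumes "P \<in> trig_polys Q"
  shows "\<exists>C. \<forall>n. \<forall>z\<in>sphere 0 1. norm (P z - cesaro_mean n P z) \<le> C / real (n + 1)"
  using assms
proof (induction rule: trig_polys_induct)
  case zero
  then show ?case
    by (intro exI[of _ 0])
       (auto simp: cesaro_mean_def fourier_sum_def fourier_coeff_def scaleC.zero_right)
next
  case (add m x G)
  let ?F = "\<lambda>z. (z powi m) *\<^sub>C x"
  have F: "norm (?F z - cesaro_mean n ?F z) \<le> (nat \<bar>m\<bar> * norm x) / real (n + 1)"
    if z: "z \<in> sphere 0 1" for n z
  proof -
    have "real (n + 1) *\<^sub>R (?F z - cesaro_mean n ?F z) = (\<Sum>k=0..n. ?F z - fourier_sum k ?F z)"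
      by (simp add: cesaro_mean_def sum_subtractf scaleR_diff_right scaleR_conv_of_real
          sum_constant_scaleR)
    also have "\<dots> = (\<Sum>k\<in>{0..n} \<inter> {..<nat \<bar>m\<bar>}. ?F z)"
      unfolding fourier_sum_monomial by (intro sum.mono_neutral_cong_right) auto
    finally have "real (n + 1) * norm (?F z - cesaro_mean n ?F z)
        = norm (\<Sum>k\<in>{0..n} \<inter> {..<nat \<bar>m\<bar>}. ?F z)"
      by (metis abs_of_nat norm_scaleR)
    also have "\<dots> \<le> (\<Sum>k\<in>{0..n} \<inter> {..<nat \<bar>m\<bar>}. norm x)"
      using z by (intro sum_norm_le) (simp add: norm_scaleC norm_power_int)
    also have "\<dots> \<le> (\<Sum>k\<in>{..<nat \<bar>m\<bar>}. norm x)" by (intro sum_mono2) auto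
    finally show ?thesis by (simp add: field_simps)
  qed
  from add obtain C where C: "\<And>n z. z \<in> sphere 0 1 \<Longrightarrow> norm (G z - cesaro_mean n G z) \<le> C / real (n + 1)"
    by blast
  have int: "integrable circle ?F" "integrable circle G"
    using add by (auto intro!: trig_polys_integrable[of _ Q] trig_polys_monomial)
  show ?case
  proof (intro exI[of _ "nat \<bar>m\<bar> * norm x + C"] allI ballI)
    fix n z assume z: "z \<in> sphere (0::complex) 1"
    have "norm (?F z + G z - cesaro_mean n (\<lambda>z. ?F z + G z) z)
        = norm ((?F z - cesaro_mean n ?F z) + (G z - cesaro_mean n G z))"
      by (subst cesaro_mean_add[OF int]) (simp add: algebra_simps)
    also have "\<dots> \<le> (nat \<bar>m\<bar> * norm x) / real (n + 1) + C / real (n + 1)"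
      by (intro norm_triangle_le add_mono F C z)
    finally show "norm (?F z + G z - cesaro_mean n (\<lambda>z. ?F z + G z) z)
        \<le> (nat \<bar>m\<bar> * norm x + C) / real (n + 1)"
      by (simp add: add_divide_distrib)
  qed
qed

section \<open>Products, and real polynomials on the circle as trigonometric polynomials\<close>

lemma trig_polys_scaleC_const:
  assumes "p \<in> trig_polys Q"
  shows "(\<lambda>z. p z *\<^sub>C x) \<in> trig_polys Q"
  using assms
proof (induction rule: trig_polys_induct)
  case zero
  then show ?case by (simp add: scaleC.zero_left trig_polys_zero)
next
  case (add n c G)
  have "(\<lambda>z. ((z powi n) *\<^sub>C c + G z) *\<^sub>C x) = (\<lambda>z. (z powi n) *\<^sub>C (c *\<^sub>C x) + G z *\<^sub>C x)"
    by (simp add: scaleC_add_left scaleC_scaleC scaleC_complex_def)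
  then show ?case using trig_polys_add[OF trig_polys_monomial add(3)] add(1) by simp
qed

text \<open>Equality is claimed on the circle only: at 0 the product of two powers need not be the
  power of the sum.\<close>

lemma trig_polys_mult:
  fixes p q :: "complex \<Rightarrow> complex"
  assumes "p \<in> trig_polys (\<lambda>_. True)" "q \<in> trig_polys (\<lambda>_. True)"
  shows "\<exists>r\<in>trig_polys (\<lambda>_. True). \<forall>z\<in>sphere 0 1. r z = p z * q z"
  using assms(1)
proof (induction rule: trig_polys_induct)
  case zero
  then show ?case by (intro bexI[of _ "\<lambda>z. 0"]) (auto intro: trig_polys_zero)
next
  case (add n c G)
  have "\<exists>r\<in>trig_polys (\<lambda>_. True). \<forall>z\<in>sphere 0 1. r z = ((z powi n) *\<^sub>C c) * q z"
    using assms(2)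
  proof (induction rule: trig_polys_induct)
    case zero
    then show ?case by (intro bexI[of _ "\<lambda>z. 0"]) (auto intro: trig_polys_zero)
  next
    case (add m d H)
    then obtain r where r: "r \<in> trig_polys (\<lambda>_. True)"
      "\<And>z. z \<in> sphere 0 1 \<Longrightarrow> r z = ((z powi n) *\<^sub>C c) * H z" by auto
    show ?case
    proof (intro bexI ballI)
      show "(\<lambda>z. (z powi (n + m)) *\<^sub>C (c * d) + r z) \<in> trig_polys (\<lambda>_. True)"
        by (intro trig_polys_add trig_polys_monomial r) simp
      fix z :: complex assume z: "z \<in> sphere 0 1"
      then have "z \<noteq> 0" by auto
      with r(2)[OF z] show "(z powi (n + m)) *\<^sub>C (c * d) + r z = (z powi n) *\<^sub>C c * ((z powi m) *\<^sub>C d + H z)"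
        by (simp add: scaleC_complex_def power_int_add algebra_simps)
    qed
  qed
  then obtain r where r: "r \<in> trig_polys (\<lambda>_. True)"
      "\<And>z. z \<in> sphere 0 1 \<Longrightarrow> r z = ((z powi n) *\<^sub>C c) * q z" by auto
  from add obtain r' where r': "r' \<in> trig_polys (\<lambda>_. True)"
      "\<And>z. z \<in> sphere 0 1 \<Longrightarrow> r' z = G z * q z" by auto
  show ?case
    by (rule bexI[OF _ trig_polys_add[OF r(1) r'(1)]]) (use r(2) r'(2) in \<open>auto simp: distrib_right\<close>)
qed

text \<open>This connects Stone-Weierstrass with the circle: there the conjugate of z is 1/z, so Re
  z and Im z are trigonometric polynomials.\<close>

lemma real_polynomial_function_trig_poly:
  assumes "real_polynomial_function (f :: complex \<Rightarrow> real)"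
  shows "\<exists>r\<in>trig_polys (\<lambda>_. True). \<forall>z\<in>sphere 0 1. r z = complex_of_real (f z)"
  using assms
proof (induction rule: real_polynomial_function.induct)
  case (linear f)
  then interpret f: bounded_linear f .
  \<comment> \<open>The coefficients of z and of its conjugate in Re z * f 1 + Im z * f \<i>, from
    Re z = (z + cnj z)/2 and Im z = (z - cnj z)/(2\<i>).\<close>
  define a where "a = complex_of_real (f 1) / 2 - \<i> * of_real (f \<i>) / 2"
  define b where "b = complex_of_real (f 1) / 2 + \<i> * of_real (f \<i>) / 2"
  show ?case
  proof (intro bexI ballI)
    show "(\<lambda>z. (z powi 1) *\<^sub>C a + (z powi (-1)) *\<^sub>C b) \<in> trig_polys (\<lambda>_. True)"
      by (intro trig_polys_add trig_polys_monomial) auto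
    fix z :: complex assume z: "z \<in> sphere 0 1"
    then have "z * cnj z = 1" by (simp flip: complex_norm_square)
    then have zc: "z powi (-1) = cnj z"
      by (metis inverse_unique power_int_minus1_right)
    have "f z = f (Re z *\<^sub>R 1 + Im z *\<^sub>R \<i>)"
      by (rule arg_cong[of _ _ f]) (simp add: complex_eq_iff)
    also have "\<dots> = Re z * f 1 + Im z * f \<i>" by (simp add: f.add f.scaleR)
    finally show "(z powi 1) *\<^sub>C a + (z powi (-1)) *\<^sub>C b = complex_of_real (f z)"
      unfolding zc by (simp add: a_def b_def scaleC_complex_def complex_eq_iff algebra_simps)
  qed
next
  case (const c)
  show ?case
    using trig_polys_monomial[of "\<lambda>_. True" 0 "complex_of_real c"]
    by (intro bexI[of _ "\<lambda>z. (z powi 0) *\<^sub>C complex_of_real c"]) (auto simp: scaleC_complex_def)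
next
  case (add f g)
  then obtain r s where r: "r \<in> trig_polys (\<lambda>_. True)" "\<And>z. z \<in> sphere 0 1 \<Longrightarrow> r z = complex_of_real (f z)"
    and s: "s \<in> trig_polys (\<lambda>_. True)" "\<And>z. z \<in> sphere 0 1 \<Longrightarrow> s z = complex_of_real (g z)" by auto
  show ?case
    by (rule bexI[OF _ trig_polys_add[OF r(1) s(1)]]) (use r(2) s(2) in auto)
next
  case (mult f g)
  then obtain r s where r: "r \<in> trig_polys (\<lambda>_. True)" "\<And>z. z \<in> sphere 0 1 \<Longrightarrow> r z = complex_of_real (f z)"
    and s: "s \<in> trig_polys (\<lambda>_. True)" "\<And>z. z \<in> sphere 0 1 \<Longrightarrow> s z = complex_of_real (g z)" by auto
  then show ?case using trig_polys_mult[OF r(1) s(1)] by auto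
qed

section \<open>Quadrature over roots of unity\<close>

definition dirichlet_kernel :: "nat \<Rightarrow> complex \<Rightarrow> complex" where
  "dirichlet_kernel k w = (\<Sum>i\<in>{- int k..int k}. w powi i)"

text \<open>The left side is n+1 times the Fejer kernel, and the square on the right gives its
  positivity. In the induction, write A for the geometric sum up to n and N for w^(n+1): passing
  from A * cnj A to (A + N) * cnj (A + N) adds A * cnj N + N * cnj A + 1, which is exactly the next
  Dirichlet kernel.\<close>

lemma sum_dirichlet_kernel:
  assumes "w \<in> sphere 0 1"
  shows "(\<Sum>k=0..n. dirichlet_kernel k w) = of_real ((cmod (\<Sum>k=0..n. w ^ k))\<^sup>2)"
proof -
  have w: "w * cnj w = 1" "w \<noteq> 0" using assms by (auto simp flip: complex_norm_square)
  then have inv: "cnj w = inverse w" by (simp add: field_simps)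
  have "(\<Sum>k=0..n. dirichlet_kernel k w) = (\<Sum>k=0..n. w ^ k) * cnj (\<Sum>k=0..n. w ^ k)"
  proof (induction n)
    case 0
    then show ?case by (simp add: dirichlet_kernel_def)
  next
    case (Suc n)
    let ?A = "\<Sum>k=0..n. w ^ k" and ?B = "\<Sum>k=0..n. w ^ Suc k" and ?N = "w ^ Suc n"
    \<comment> \<open>On the circle w^k cancels k of the n+1 factors of cnj w; reversing the order
      of summation turns the exponents n+1-k into k+1.\<close>
    have A1: "?A * cnj ?N = cnj ?B"
    proof -
      have "?A * cnj ?N = (\<Sum>k=0..n. cnj (w ^ (Suc n - k)))"
        unfolding sum_distrib_right
      proof (rule sum.cong)
        fix k assume "k \<in> {0..n}"
        then have "Suc n = k + (Suc n - k)" by simp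
        then have "cnj w ^ Suc n = cnj w ^ k * cnj w ^ (Suc n - k)" by (metis power_add)
        moreover have "w ^ k * cnj w ^ k = 1" using w by (simp flip: power_mult_distrib)
        ultimately show "w ^ k * cnj (w ^ Suc n) = cnj (w ^ (Suc n - k))"
          by (metis complex_cnj_power mult.assoc mult_1)
      qed simp
      also have "\<dots> = (\<Sum>k=0..n. cnj (w ^ Suc k))"
        by (rule sum.reindex_bij_witness[of _ "\<lambda>k. n - k" "\<lambda>k. n - k"]) (auto simp: Suc_diff_le)
      finally show ?thesis by simp
    qed
    have A2: "?N * cnj ?A = ?B" using arg_cong[OF A1, of cnj] by (simp add: mult.commute)
    have A3: "?N * cnj ?N = 1"
      using w(1) by (metis complex_cnj_power power_mult_distrib power_one)
    have "dirichlet_kernel (Suc n) w = 1 + ?B + cnj ?B"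
    proof (induction n)
      case 0
      have "{-1..1} = {-1, 0, 1 :: int}" by auto
      then show ?case by (simp add: dirichlet_kernel_def inv)
    next
      case (Suc n)
      have "{- int (Suc (Suc n))..int (Suc (Suc n))}
          = insert (- int (Suc (Suc n))) (insert (int (Suc (Suc n))) {- int (Suc n)..int (Suc n)})"
        by auto
      then have "dirichlet_kernel (Suc (Suc n)) w
          = w powi (- int (Suc (Suc n))) + (w powi int (Suc (Suc n)) + dirichlet_kernel (Suc n) w)"
        by (simp add: dirichlet_kernel_def)
      also have "w powi (- int (Suc (Suc n))) = cnj (w ^ Suc (Suc n))"
        by (simp only: power_int_minus power_int_of_nat complex_cnj_power inv power_inverse)
      finally show ?case by (simp add: Suc power_int_of_nat del: of_nat_Suc)
    qed
    then show ?case using Suc A1 A2 A3 by (simp add: algebra_simps)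
  qed
  then show ?thesis by (simp add: complex_norm_square del: of_real_power)
qed

text \<open>Discrete orthogonality. The bound on k prevents a nonzero k from being a multiple of M,
  so x = e^(2 pi i k/M) differs from 1 while x^M = 1, and the geometric sum vanishes.\<close>

lemma sum_powi_roots_of_unity:
  assumes "\<bar>k\<bar> < int M"
  shows "(\<Sum>j<M. cis (2 * pi * real j / real M) powi k) = (if k = 0 then of_nat M else 0)"
proof (cases "k = 0")
  case False
  have M: "M > 0" using assms by simp
  let ?x = "cis (2 * pi * k / M)"
  have "?x \<noteq> 1"
  proof
    assume "?x = 1"
    then have "exp (of_real (2 * pi * k / M) * \<i>) = 1" by (simp add: cis_conv_exp mult.commute)
    then obtain n :: int where "2 * pi * k / M = of_int (2 * n) * pi"
      unfolding exp_eq_1 by auto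
    then have "real_of_int k = real_of_int (n * int M)" using M by (simp add: field_simps)
    then have "k = n * int M" by linarith
    then show False using assms False
      by (metis abs_mult abs_of_nat mult_cancel_right1 mult_eq_0_iff mult_le_cancel_right1 not_le
          zabs_less_one_iff zero_le_mult_iff abs_ge_zero linorder_not_less)
  qed
  moreover have "?x ^ M = 1"
  proof -
    have "?x ^ M = cis (real M * (2 * pi * k / M))" by (rule Complex.DeMoivre)
    also have "real M * (2 * pi * k / M) = 2 * pi * k" using M by simp
    also have "cis (2 * pi * k) = 1" by (rule cis_multiple_2pi) simp
    finally show ?thesis .
  qed
  moreover have "cis (2 * pi * real j / real M) powi k = ?x ^ j" for j
    by (simp add: cis_power_int Complex.DeMoivre mult_ac)
  ultimately show ?thesis using False by (simp add: geometric_sum)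
qed simp

text \<open>Averaging over M-th roots of unity agrees with integration on frequencies below M in
  absolute value, so convolution with the Dirichlet kernel is an exact finite sum. Saying "for all
  large M" avoids tracking the degree of P, and the thresholds of the summands combine by
  themselves.\<close>

lemma fourier_sum_quadrature:
  fixes P :: "complex \<Rightarrow> 'x::{complex_banach,second_countable_topology}"
  assumes "P \<in> trig_polys Q"
  shows "\<forall>\<^sub>F M in sequentially. \<forall>z\<in>sphere 0 1. fourier_sum k P z =
    (1 / real M) *\<^sub>R (\<Sum>j<M. dirichlet_kernel k (cis (2 * pi * real j / real M)) *\<^sub>C
                          P (cnj (cis (2 * pi * real j / real M)) * z))"
  using assms
proof (induction rule: trig_polys_induct)
  case zero
  then show ?case by (simp add: fourier_sum_def fourier_coeff_def scaleC.zero_right)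
next
  case (add m x G)
  let ?F = "\<lambda>z. (z powi m) *\<^sub>C x"
  have int: "integrable circle ?F" "integrable circle G"
    using add by (auto intro!: trig_polys_integrable[of _ Q] trig_polys_monomial)
  let ?w = "\<lambda>M j. cis (2 * pi * real j / real M)"
  \<comment> \<open>The frequencies i - m that occur below have absolute value at most k + |m|,
    hence less than M.\<close>
  have "\<forall>\<^sub>F M in sequentially. M > k + nat \<bar>m\<bar>" by (rule eventually_gt_at_top)
  then show ?case using add(3)
  proof eventually_elim
    case (elim M)
    have M: "M > 0" using elim by simp
    have "(\<Sum>j<M. dirichlet_kernel k (?w M j) * ?w M j powi (- m))
        = (\<Sum>i\<in>{- int k..int k}. \<Sum>j<M. ?w M j powi (i - m))"
      unfolding dirichlet_kernel_def sum_distrib_right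
      by (subst sum.swap) (simp flip: power_int_add add: power_int_add)
    also have "\<dots> = (\<Sum>i\<in>{- int k..int k}. if i = m then of_nat M else 0)"
      by (intro sum.cong refl, subst sum_powi_roots_of_unity) (use elim in auto)
    also have "\<dots> = (if \<bar>m\<bar> \<le> int k then of_nat M else 0)"
      by (auto simp: sum.delta)
    finally have D: "(\<Sum>j<M. dirichlet_kernel k (?w M j) * ?w M j powi (- m))
      = (if \<bar>m\<bar> \<le> int k then of_nat M else 0)" .
    show ?case
    proof
      fix z :: complex assume z: "z \<in> sphere 0 1"
      have "(\<Sum>j<M. dirichlet_kernel k (?w M j) *\<^sub>C ?F (cnj (?w M j) * z))
          = (\<Sum>j<M. (dirichlet_kernel k (?w M j) * ?w M j powi (- m)) *\<^sub>C ?F z)"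
        by (simp add: power_int_mult_distrib scaleC_scaleC cis_cnj cis_power_int mult_ac)
      also have "\<dots> = (if \<bar>m\<bar> \<le> int k then of_nat M else 0) *\<^sub>C ?F z"
        unfolding D[symmetric] by (simp add: scaleC.sum_left)
      also have "\<dots> = real M *\<^sub>R fourier_sum k ?F z"
        by (simp add: fourier_sum_monomial scaleR_scaleC scaleC.zero_left scaleC.zero_right)
      finally have "fourier_sum k ?F z
        = (1 / real M) *\<^sub>R (\<Sum>j<M. dirichlet_kernel k (?w M j) *\<^sub>C ?F (cnj (?w M j) * z))"
        using M by simp
      then show "fourier_sum k (\<lambda>z. ?F z + G z) z = (1 / real M) *\<^sub>R
          (\<Sum>j<M. dirichlet_kernel k (?w M j) *\<^sub>C (?F (cnj (?w M j) * z) + G (cnj (?w M j) * z)))"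
        using elim z
        by (subst fourier_sum_add[OF int])
           (simp add: scaleC_add_right sum.distrib scaleR_add_right)
    qed
  qed
qed

lemma cesaro_mean_convex_combination:
  fixes P :: "complex \<Rightarrow> 'x::{complex_banach,second_countable_topology}"
  assumes "P \<in> trig_polys Q"
  obtains M :: nat and w :: "nat \<Rightarrow> complex" and l :: "nat \<Rightarrow> real"
  where "\<And>j. w j \<in> sphere 0 1" "\<And>j. 0 \<le> l j" "(\<Sum>j<M. l j) = 1"
    "\<And>z. z \<in> sphere 0 1 \<Longrightarrow> cesaro_mean n P z = (\<Sum>j<M. l j *\<^sub>R P (cnj (w j) * z))"
proof -
  let ?w = "\<lambda>M j. cis (2 * pi * real j / real M)"
  \<comment> \<open>Only finitely many partial sums enter, so one M serves all of them.\<close>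
  have "\<forall>\<^sub>F M in sequentially. \<forall>k\<in>{0..n}. \<forall>z\<in>sphere 0 1. fourier_sum k P z =
    (1 / real M) *\<^sub>R (\<Sum>j<M. dirichlet_kernel k (?w M j) *\<^sub>C P (cnj (?w M j) * z))"
    by (intro eventually_ball_finite ballI fourier_sum_quadrature[OF assms]) simp
  from eventually_happens[OF eventually_conj[OF this eventually_gt_at_top[of n]]]
  obtain M where M: "M > n" and S: "\<And>k z. k \<le> n \<Longrightarrow> z \<in> sphere 0 1 \<Longrightarrow> fourier_sum k P z =
    (1 / real M) *\<^sub>R (\<Sum>j<M. dirichlet_kernel k (?w M j) *\<^sub>C P (cnj (?w M j) * z))"
    by auto
  \<comment> \<open>The weight is the Fejer kernel at the j-th root of unity divided by M.\<close>
  define l where "l j = (cmod (\<Sum>k=0..n. ?w M j ^ k))\<^sup>2 / (real (n + 1) * real M)" for j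
  have l: "(\<Sum>k=0..n. dirichlet_kernel k (?w M j)) = of_real (real (n + 1) * real M * l j)" for j
    using M by (subst sum_dirichlet_kernel) (auto simp: l_def)
  show ?thesis
  proof (rule that[of "?w M" l M])
    show "0 \<le> l j" for j by (simp add: l_def)
    \<comment> \<open>Summation over the roots kills every frequency i \<noteq> 0, as |i| \<le> n <
      M. The frequency 0 occurs once in each of the n+1 Dirichlet kernels.\<close>
    have "of_real (real (n + 1) * real M * (\<Sum>j<M. l j)) = (\<Sum>j<M. \<Sum>k=0..n. dirichlet_kernel k (?w M j))"
      unfolding l by (simp add: sum_distrib_left)
    also have "\<dots> = (\<Sum>k=0..n. \<Sum>i\<in>{- int k..int k}. \<Sum>j<M. ?w M j powi i)"
      unfolding dirichlet_kernel_def by (subst sum.swap, intro sum.cong refl, rule sum.swap)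
    also have "\<dots> = (\<Sum>k=0..n. \<Sum>i\<in>{- int k..int k}. if i = 0 then of_nat M else 0)"
      by (intro sum.cong refl sum_powi_roots_of_unity) (use M in auto)
    also have "\<dots> = of_real (real (n + 1) * real M)" by (simp add: sum.delta)
    finally have "real (n + 1) * real M * (\<Sum>j<M. l j) = real (n + 1) * real M"
      unfolding of_real_eq_iff .
    then show "(\<Sum>j<M. l j) = 1" using M by simp
    show "cesaro_mean n P z = (\<Sum>j<M. l j *\<^sub>R P (cnj (?w M j) * z))" if "z \<in> sphere 0 1" for z
    proof -
      have "(\<Sum>k=0..n. fourier_sum k P z) = (1 / real M) *\<^sub>R
          (\<Sum>k=0..n. \<Sum>j<M. dirichlet_kernel k (?w M j) *\<^sub>C P (cnj (?w M j) * z))"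
        using that by (simp add: S scaleR_sum_right)
      also have "\<dots> = (1 / real M) *\<^sub>R
          (\<Sum>j<M. (\<Sum>k=0..n. dirichlet_kernel k (?w M j)) *\<^sub>C P (cnj (?w M j) * z))"
        by (subst sum.swap) (simp add: scaleC.sum_left)
      also have "\<dots> = (\<Sum>j<M. (real (n + 1) * l j) *\<^sub>R P (cnj (?w M j) * z))"
        using M unfolding l scaleR_scaleC[symmetric] by (simp add: scaleR_sum_right)
      finally show ?thesis
        by (simp add: cesaro_mean_def scaleR_sum_right)
    qed
  qed simp
qed

section \<open>The norm and its extension\<close>

lemma LinfI:
  assumes "f \<in> borel_measurable circle" "\<And>z. z \<in> sphere 0 1 \<Longrightarrow> cmod (f z) \<le> C"
  shows "f \<in> Linf"
  using assms unfolding Linf_def by (auto intro!: exI[of _ C] AE_I2)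

lemma Linf_measurable: "f \<in> Linf \<Longrightarrow> f \<in> borel_measurable circle"
  by (simp add: Linf_def)

lemma Linf_bound:
  assumes "f \<in> Linf"
  obtains C where "0 \<le> C" "AE z in circle. cmod (f z) \<le> C"
proof -
  obtain C where "AE z in circle. cmod (f z) \<le> C" using assms by (auto simp: Linf_def)
  then show ?thesis by (intro that[of "max 0 C"]) auto
qed

lemma Linf_dominated:
  assumes "g \<in> Linf" "f \<in> borel_measurable circle" "AE z in circle. cmod (f z) \<le> cmod (g z)"
  shows "f \<in> Linf"
proof -
  obtain C where "AE z in circle. cmod (g z) \<le> C" using Linf_bound[OF assms(1)] by blast
  with assms(3) have "AE z in circle. cmod (f z) \<le> C" by eventually_elim simp
  then show ?thesis using assms(2) by (auto simp: Linf_def)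
qed

lemma Linf_add:
  assumes "f \<in> Linf" "g \<in> Linf"
  shows "(\<lambda>z. f z + g z) \<in> Linf"
proof -
  obtain C D where C: "AE z in circle. cmod (f z) \<le> C" and D: "AE z in circle. cmod (g z) \<le> D"
    using Linf_bound[OF assms(1)] Linf_bound[OF assms(2)] by metis
  from C D have "AE z in circle. cmod (f z + g z) \<le> C + D"
    by eventually_elim (intro norm_triangle_le add_mono)
  then show ?thesis using assms by (auto simp: Linf_def)
qed

lemma Linf_scale: "f \<in> Linf \<Longrightarrow> (\<lambda>z. c * f z) \<in> Linf"
proof -
  assume f: "f \<in> Linf"
  obtain C where C: "AE z in circle. cmod (f z) \<le> C"
    using Linf_bound[OF f] by metis
  from C have "AE z in circle. cmod (c * f z) \<le> cmod c * C"
    by eventually_elim (simp add: norm_mult mult_left_mono)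
  then show ?thesis using f by (auto simp: Linf_def)
qed

lemma Linf_diff: "f \<in> Linf \<Longrightarrow> g \<in> Linf \<Longrightarrow> (\<lambda>z. f z - g z) \<in> Linf"
  using Linf_add[of f "\<lambda>z. -1 * g z"] Linf_scale[of g "-1"] by simp

lemma Linf_cmod:
  assumes "f \<in> Linf"
  shows "(\<lambda>z. complex_of_real (cmod (f z))) \<in> Linf"
  by (rule Linf_dominated[OF assms]) (use Linf_measurable[OF assms] in auto)

lemma Linf_const: "(\<lambda>z. c) \<in> Linf"
  by (rule LinfI[of _ "cmod c"]) auto

lemma Linf_sum: "(\<And>i. i \<in> I \<Longrightarrow> f i \<in> Linf) \<Longrightarrow> (\<lambda>z. \<Sum>i\<in>I. f i z) \<in> Linf"
  by (induction I rule: infinite_finite_induct) (auto intro: Linf_const Linf_add)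

lemma Linf_indicator: "E \<in> sets circle \<Longrightarrow> indicator E \<in> Linf"
  by (rule LinfI[of _ 1]) (auto simp: indicator_def)

lemma Linf_simple:
  assumes "simple_function circle s"
  shows "s \<in> Linf"
proof -
  have "finite (s ` sphere 0 1)" using simple_functionD(1)[OF assms] by simp
  then have "finite (cmod ` s ` sphere 0 1)" by blast
  then have "\<exists>C. \<forall>z\<in>sphere 0 1. cmod (s z) \<le> C"
    by (meson Max_ge image_eqI)
  then show ?thesis
    using assms by (auto intro: LinfI borel_measurable_simple_function)
qed

lemma Linf_norm_fun_trig_poly:
  fixes P :: "complex \<Rightarrow> 'x::{complex_banach,second_countable_topology}"
  assumes "P \<in> trig_polys Q"
  shows "norm_fun P \<in> Linf"
proof -
  obtain C where "\<And>z. z \<in> sphere 0 1 \<Longrightarrow> norm (P z) \<le> C"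
    using trig_polys_bounded[OF assms] by blast
  then show ?thesis
    unfolding norm_fun_def using trig_polys_measurable[OF assms] by (intro LinfI[of _ C]) auto
qed

lemma Linf_trig_poly:
  assumes "P \<in> trig_polys Q"
  shows "P \<in> Linf"
  by (rule Linf_dominated[OF Linf_norm_fun_trig_poly[OF assms] trig_polys_measurable[OF assms]])
     (simp add: norm_fun_def)

section \<open>Consequences of the axioms for bounded functions, and the extended norm\<close>

context continuous_rot_sym_norm
begin

lemma alpha_AE_le:
  assumes f: "f \<in> Linf" and g: "g \<in> Linf" and ae: "AE z in circle. f z = g z"
  shows "\<alpha> f \<le> \<alpha> g"
proof -
  have "\<alpha> (\<lambda>z. f z - g z) = 0"
    using zero_iff[OF Linf_diff[OF f g]] ae by auto
  with triangle[OF Linf_diff[OF f g] g] show ?thesis by simp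
qed

text \<open>A nonnegative function bounded by \<open>g\<close> is the average of two functions of modulus \<open>g\<close>.\<close>

lemma alpha_mono:
  assumes f: "f \<in> Linf" and g: "g \<in> Linf" and ae: "AE z in circle. cmod (f z) \<le> cmod (g z)"
  shows "\<alpha> f \<le> \<alpha> g"
proof -
  \<comment> \<open>The bound |f| \<le> |g| holds only almost everywhere; the minimum makes it hold
    at every point, so the square root in \<open>b\<close> has a nonnegative argument.\<close>
  define a where "a z = min (cmod (f z)) (cmod (g z))" for z
  define b where "b z = sqrt ((cmod (g z))\<^sup>2 - (a z)\<^sup>2)" for z
  \<comment> \<open>The points a + \<i>b and a - \<i>b lie on the circle of radius |g| and have
    midpoint a.\<close>
  define h where "h s z = Complex (a z) (s * b z)" for s z
  have [measurable]: "f \<in> borel_measurable circle" "g \<in> borel_measurable circle"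
    using f g by (auto dest: Linf_measurable)
  have ab: "0 \<le> a z" "a z \<le> cmod (g z)" for z by (auto simp: a_def)
  have b2: "(b z)\<^sup>2 = (cmod (g z))\<^sup>2 - (a z)\<^sup>2" for z
    using ab[of z] by (simp add: b_def power_mono)
  have h: "cmod (h s z) = cmod (g z)" if "s = 1 \<or> s = -1" for s z
  proof -
    have "(s * b z)\<^sup>2 = (cmod (g z))\<^sup>2 - (a z)\<^sup>2" using that b2[of z] by auto
    then show ?thesis by (simp add: h_def cmod_def)
  qed
  have [measurable]: "h s \<in> borel_measurable circle" for s
    unfolding h_def Complex_eq a_def b_def by measurable
  have hL: "h s \<in> Linf" if "s = 1 \<or> s = -1" for s
    by (rule Linf_dominated[OF g]) (auto simp: h[OF that])
  have ah: "\<alpha> (h s) = \<alpha> g" if "s = 1 \<or> s = -1" for s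
    using modulus[OF hL[OF that]] modulus[OF g] h[OF that] by simp
  have sL: "(\<lambda>z. h 1 z + h (-1) z) \<in> Linf" by (intro Linf_add hL) auto
  have "\<alpha> f = \<alpha> (\<lambda>z. complex_of_real (cmod (f z)))" by (simp add: modulus[OF f])
  also have "\<dots> \<le> \<alpha> (\<lambda>z. (1/2) * (h 1 z + h (-1) z))"
  proof (rule alpha_AE_le[OF Linf_cmod[OF f] Linf_scale[OF sL]])
    show "AE z in circle. complex_of_real (cmod (f z)) = (1/2) * (h 1 z + h (-1) z)"
      using ae by eventually_elim (auto simp: h_def a_def complex_eq_iff)
  qed
  also have "\<dots> = (1/2) * \<alpha> (\<lambda>z. h 1 z + h (-1) z)"
    by (subst scale[OF sL]) simp
  also have "\<dots> \<le> (1/2) * (\<alpha> (h 1) + \<alpha> (h (-1)))"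
    by (intro mult_left_mono triangle hL) auto
  also have "\<dots> = \<alpha> g" by (simp add: ah)
  finally show ?thesis .
qed

lemma alpha_const: "\<alpha> (\<lambda>z. c) = cmod c"
  using scale[OF Linf_const[of 1], of c] normalized by simp

lemma alpha_le_const:
  assumes "f \<in> Linf" "0 \<le> C" "AE z in circle. cmod (f z) \<le> C"
  shows "\<alpha> f \<le> C"
  using alpha_mono[OF assms(1) Linf_const[of "of_real C"]] assms(2,3) alpha_const[of "of_real C"] by simp

lemma alpha_sum_le:
  assumes "finite I" "\<And>i. i \<in> I \<Longrightarrow> f i \<in> Linf"
  shows "\<alpha> (\<lambda>z. \<Sum>i\<in>I. f i z) \<le> (\<Sum>i\<in>I. \<alpha> (f i))"
  using assms
proof (induction I rule: finite_induct)
  case empty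
  then show ?case using alpha_const[of 0] by simp
next
  case (insert i I)
  have "\<alpha> (\<lambda>z. f i z + (\<Sum>i\<in>I. f i z)) \<le> \<alpha> (f i) + \<alpha> (\<lambda>z. \<Sum>i\<in>I. f i z)"
    using insert by (intro triangle Linf_sum) auto
  with insert show ?case by fastforce
qed

lemma alpha_cesaro_mean_le:
  fixes P :: "complex \<Rightarrow> 'x::{complex_banach,second_countable_topology}"
  assumes P: "P \<in> trig_polys Q"
  shows "\<alpha> (norm_fun (cesaro_mean n P)) \<le> \<alpha> (norm_fun P)"
proof -
  obtain M :: nat and w :: "nat \<Rightarrow> complex" and l :: "nat \<Rightarrow> real"
    where w: "\<And>j. w j \<in> sphere 0 1" and l: "\<And>j. 0 \<le> l j" "(\<Sum>j<M. l j) = 1"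
    and c: "\<And>z. z \<in> sphere 0 1 \<Longrightarrow> cesaro_mean n P z = (\<Sum>j<M. l j *\<^sub>R P (cnj (w j) * z))"
    by (rule cesaro_mean_convex_combination[OF P, of n]) blast
  note PL = Linf_norm_fun_trig_poly[OF P]
  define f where "f j = (\<lambda>z. norm_fun P (cnj (w j) * z))" for j
  have cL: "norm_fun (cesaro_mean n P) \<in> Linf"
    by (rule Linf_norm_fun_trig_poly[OF cesaro_mean_in_trig_polys[of "\<lambda>_. True"]]) auto
  have fL: "f j \<in> Linf" for j
  proof -
    obtain C where "\<And>z. z \<in> sphere 0 1 \<Longrightarrow> norm (P z) \<le> C"
      using trig_polys_bounded[OF P] by blast
    then show ?thesis
      unfolding f_def using w[of j]
      by (intro LinfI[of _ C] measurable_compose[OF measurable_rotate_circle Linf_measurable[OF PL]])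
         (auto simp: norm_fun_def norm_mult)
  qed
  \<comment> \<open>The pointwise triangle inequality bounds |\<sigma>_n P| by a convex combination
    of rotations of |P|; all of these have the same \<alpha>.\<close>
  have "\<alpha> (norm_fun (cesaro_mean n P)) \<le> \<alpha> (\<lambda>z. \<Sum>j<M. of_real (l j) * f j z)"
  proof (rule alpha_mono[OF cL])
    show "(\<lambda>z. \<Sum>j<M. of_real (l j) * f j z) \<in> Linf"
      by (intro Linf_sum Linf_scale fL)
    show "AE z in circle. cmod (norm_fun (cesaro_mean n P) z) \<le> cmod (\<Sum>j<M. of_real (l j) * f j z)"
    proof (rule AE_I2)
      fix z assume z: "z \<in> space circle"
      have "norm (cesaro_mean n P z) \<le> (\<Sum>j<M. l j * norm (P (cnj (w j) * z)))"
        using z l by (subst c) (auto intro!: sum_norm_le)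
      also have "\<dots> = cmod (of_real (\<Sum>j<M. l j * norm (P (cnj (w j) * z))))"
        using l by (simp add: sum_nonneg del: of_real_sum)
      finally show "cmod (norm_fun (cesaro_mean n P) z) \<le> cmod (\<Sum>j<M. of_real (l j) * f j z)"
        by (simp add: norm_fun_def f_def)
    qed
  qed
  also have "\<dots> \<le> (\<Sum>j<M. \<alpha> (\<lambda>z. of_real (l j) * f j z))"
    by (intro alpha_sum_le Linf_scale fL) simp
  also have "\<dots> = (\<Sum>j<M. l j * \<alpha> (norm_fun P))"
    using rotation[OF PL w] l by (intro sum.cong refl, subst scale[OF fL]) (simp add: f_def)
  also have "\<dots> = \<alpha> (norm_fun P)"
    using l by (simp flip: sum_distrib_right)
  finally show ?thesis .
qed

lemma cmod_integral_trig_poly_le: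
  assumes P: "P \<in> trig_polys Q"
  shows "cmod (\<integral>z. P z \<partial>circle) \<le> \<alpha> P"
proof -
  note PL = Linf_trig_poly[OF P]
  have "cesaro_mean 0 P = (\<lambda>z. \<integral>z. P z \<partial>circle)"
    by (simp add: cesaro_mean_def fourier_sum_def fourier_coeff_def scaleC_complex_def fun_eq_iff)
  with alpha_cesaro_mean_le[OF P, of 0] show ?thesis
    using alpha_const modulus[OF PL] by (simp add: norm_fun_def)
qed

text \<open>The supremum defining \<open>ext_norm\<close> sees only simple functions, so |b| is
  rounded down to a multiple of e; this loses at most e in the uniform norm and hence in \<alpha>.
  Later arguments may then test the extended norm against any bounded function.\<close>

lemma alpha_le_ext_norm:
  assumes b: "b \<in> Linf" and ae: "AE z in circle. cmod (b z) \<le> cmod (f z)"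
  shows "ennreal (\<alpha> b) \<le> ext_norm \<alpha> f"
proof (rule ennreal_le_epsilon)
  fix e :: real assume e: "0 < e"
  obtain C where C: "0 \<le> C" "AE z in circle. cmod (b z) \<le> C" using Linf_bound[OF b] by blast
  \<comment> \<open>The essential bound is enforced at every point: a simple function must take
    finitely many values everywhere, not just off a null set.\<close>
  define m where "m z = min (cmod (b z)) C" for z
  define t where "t z = complex_of_real (e * of_int \<lfloor>m z / e\<rfloor>)" for z
  have [measurable]: "b \<in> borel_measurable circle" using b by (rule Linf_measurable)
  have m0: "0 \<le> m z" "m z \<le> C" for z using C by (auto simp: m_def)
  have fl: "0 \<le> \<lfloor>m z / e\<rfloor>" "e * of_int \<lfloor>m z / e\<rfloor> \<le> m z" "m z - e \<le> e * of_int \<lfloor>m z / e\<rfloor>" for z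
  proof -
    show "0 \<le> \<lfloor>m z / e\<rfloor>" using m0 e by simp
    show "e * of_int \<lfloor>m z / e\<rfloor> \<le> m z"
      using of_int_floor_le[of "m z / e"] pos_le_divide_eq[OF e] by (metis mult.commute)
    have "m z / e - 1 \<le> of_int \<lfloor>m z / e\<rfloor>" by linarith
    then have "e * (m z / e - 1) \<le> e * of_int \<lfloor>m z / e\<rfloor>" using e by (intro mult_left_mono) auto
    then show "m z - e \<le> e * of_int \<lfloor>m z / e\<rfloor>" using e by (simp add: right_diff_distrib)
  qed
  have "t ` space circle \<subseteq> (\<lambda>k. complex_of_real (e * of_int k)) ` {0..\<lfloor>C / e\<rfloor>}"
  proof
    fix y assume "y \<in> t ` space circle"
    then obtain z where "y = t z" by auto
    moreover have "\<lfloor>m z / e\<rfloor> \<le> \<lfloor>C / e\<rfloor>"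
      using m0[of z] e by (intro floor_mono divide_right_mono) auto
    ultimately show "y \<in> (\<lambda>k. complex_of_real (e * of_int k)) ` {0..\<lfloor>C / e\<rfloor>}"
      using fl by (auto simp: t_def)
  qed
  then have "finite (t ` space circle)" by (rule finite_subset) auto
  moreover have "t \<in> borel_measurable circle" unfolding t_def m_def by measurable
  ultimately have t: "simple_function circle t" by (simp add: simple_function_borel_measurable)
  have tm: "cmod (t z) \<le> m z" for z
    using fl[of z] e unfolding t_def norm_of_real by simp
  have tf: "AE z in circle. cmod (t z) \<le> cmod (f z)"
    using ae
  proof eventually_elim
    case (elim z)
    then show ?case using tm[of z] by (simp add: m_def)
  qed
  have "\<alpha> b = \<alpha> (\<lambda>z. complex_of_real (cmod (b z)))" by (simp add: modulus[OF b])
  also have "\<dots> = \<alpha> (\<lambda>z. t z + (complex_of_real (cmod (b z)) - t z))" by simp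
  also have "\<dots> \<le> \<alpha> t + \<alpha> (\<lambda>z. complex_of_real (cmod (b z)) - t z)"
    by (intro triangle Linf_simple t Linf_diff Linf_cmod b)
  also have "\<alpha> (\<lambda>z. complex_of_real (cmod (b z)) - t z) \<le> e"
  proof (rule alpha_le_const)
    show "AE z in circle. cmod (complex_of_real (cmod (b z)) - t z) \<le> e"
      using C(2)
    proof eventually_elim
      case (elim z)
      then have "m z = cmod (b z)" by (simp add: m_def)
      then have eq: "complex_of_real (cmod (b z)) - t z = of_real (m z - e * of_int \<lfloor>m z / e\<rfloor>)"
        by (simp add: t_def)
      show ?case unfolding eq norm_of_real using fl[of z] by (simp add: abs_le_iff)
    qed
    show "(\<lambda>z. complex_of_real (cmod (b z)) - t z) \<in> Linf"
      by (intro Linf_diff Linf_cmod b Linf_simple t)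
  qed (use e in simp)
  finally have "ennreal (\<alpha> b) \<le> ennreal (\<alpha> t + e)" by (simp add: ennreal_leI)
  also have "\<dots> = ennreal (\<alpha> t) + ennreal e"
    using e nonneg[OF Linf_simple[OF t]] by (simp add: ennreal_plus)
  also have "ennreal (\<alpha> t) \<le> ext_norm \<alpha> f"
    unfolding ext_norm_def by (rule SUP_upper) (use t tf in auto)
  finally show "ennreal (\<alpha> b) \<le> ext_norm \<alpha> f + ennreal e" by simp
qed

lemma ext_norm_mono:
  assumes "AE z in circle. cmod (f z) \<le> cmod (g z)"
  shows "ext_norm \<alpha> f \<le> ext_norm \<alpha> g"
  unfolding ext_norm_def
proof (rule SUP_subset_mono)
  have "AE z in circle. cmod (s z) \<le> cmod (g z)" if "AE z in circle. cmod (s z) \<le> cmod (f z)"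
    for s :: "complex \<Rightarrow> complex"
    using that assms by eventually_elim simp
  then show "{s. simple_function circle s \<and> (AE z in circle. cmod (s z) \<le> cmod (f z))}
      \<subseteq> {s. simple_function circle s \<and> (AE z in circle. cmod (s z) \<le> cmod (g z))}" by blast
qed simp

lemma ext_norm_Linf:
  assumes "f \<in> Linf"
  shows "ext_norm \<alpha> f = ennreal (\<alpha> f)"
proof (rule antisym)
  show "ext_norm \<alpha> f \<le> ennreal (\<alpha> f)"
    unfolding ext_norm_def by (auto intro!: SUP_least ennreal_leI alpha_mono assms Linf_simple)
qed (auto intro: alpha_le_ext_norm assms)

text \<open>A simple s below |g| + |h| is split in the proportion |g| : |h|. The two pieces are
  bounded but in general no longer simple, which is why \<open>alpha_le_ext_norm\<close> is
  needed.\<close>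

lemma ext_norm_triangle:
  assumes [measurable]: "g \<in> borel_measurable circle" "h \<in> borel_measurable circle"
    and ae: "AE z in circle. cmod (f z) \<le> cmod (g z) + cmod (h z)"
  shows "ext_norm \<alpha> f \<le> ext_norm \<alpha> g + ext_norm \<alpha> h"
  unfolding ext_norm_def[of \<alpha> f]
proof (rule SUP_least, clarify)
  fix s assume s: "simple_function circle s" and sf: "AE z in circle. cmod (s z) \<le> cmod (f z)"
  from ae sf have sle: "AE z in circle. cmod (s z) \<le> cmod (g z) + cmod (h z)" by eventually_elim simp
  have [measurable]: "s \<in> borel_measurable circle" using s by (rule borel_measurable_simple_function)
  define q where "q u z = s z * of_real (cmod (u z) / (cmod (g z) + cmod (h z)))"
    for u :: "complex \<Rightarrow> complex" and z
  have [measurable]: "q u \<in> borel_measurable circle" if [measurable]: "u \<in> borel_measurable circle" for u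
    unfolding q_def by measurable
  have qs: "cmod (q u z) \<le> cmod (s z)" if "u = g \<or> u = h" for u z
  proof -
    have "cmod (u z) / (cmod (g z) + cmod (h z)) \<le> 1"
      using that by (smt (verit) divide_le_eq_1 norm_ge_zero)
    from mult_left_mono[OF this norm_ge_zero[of "s z"]] show ?thesis
      unfolding q_def norm_mult norm_of_real by simp
  qed
  have qu: "AE z in circle. cmod (q u z) \<le> cmod (u z)" for u
    using sle
  proof eventually_elim
    case (elim z)
    have "cmod (q u z) = cmod (s z) * (cmod (u z) / (cmod (g z) + cmod (h z)))"
      unfolding q_def norm_mult norm_of_real by simp
    also have "\<dots> \<le> (cmod (g z) + cmod (h z)) * (cmod (u z) / (cmod (g z) + cmod (h z)))"
      by (intro mult_right_mono elim) auto
    also have "\<dots> \<le> cmod (u z)" by simp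
    finally show ?case .
  qed
  have qL: "q u \<in> Linf" if "u = g \<or> u = h" for u
    by (rule Linf_dominated[OF Linf_simple[OF s]]) (use that qs in auto)
  have "\<alpha> s \<le> \<alpha> (\<lambda>z. q g z + q h z)"
  proof (rule alpha_AE_le[OF Linf_simple[OF s] Linf_add[OF qL qL]])
    show "AE z in circle. s z = q g z + q h z"
      using sle
    proof eventually_elim
      case (elim z)
      show ?case
      proof (cases "cmod (g z) + cmod (h z) = 0")
        \<comment> \<open>Here both quotients have denominator 0 and default to 0, which is right
          because s vanishes too.\<close>
        case True
        with elim have "s z = 0" by simp
        then show ?thesis by (simp add: q_def)
      next
        case False
        have "q g z + q h z
          = s z * of_real ((cmod (g z) + cmod (h z)) / (cmod (g z) + cmod (h z)))"
          unfolding q_def by (simp only: add_divide_distrib of_real_add distrib_left)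
        also have "\<dots> = s z" using False by simp
        finally show ?thesis ..
      qed
    qed
  qed auto
  also have "\<dots> \<le> \<alpha> (q g) + \<alpha> (q h)" by (intro triangle qL) auto
  finally have "ennreal (\<alpha> s) \<le> ennreal (\<alpha> (q g)) + ennreal (\<alpha> (q h))"
    using nonneg[OF qL] by (simp add: ennreal_leI flip: ennreal_plus)
  also have "\<dots> \<le> ext_norm \<alpha> g + ext_norm \<alpha> h"
    by (intro add_mono alpha_le_ext_norm qL qu) auto
  finally show "ennreal (\<alpha> s) \<le> ext_norm \<alpha> g + ext_norm \<alpha> h" .
qed

end

section \<open>Smallness criteria and regularity of arc length\<close>

lemma sets_circle_borel: "E \<in> sets circle \<Longrightarrow> E \<in> sets borel"
  by (auto simp: sets_circle sets_restrict_space)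

lemma sets_circleI: "B \<in> sets borel \<Longrightarrow> B \<inter> sphere 0 1 \<in> sets circle"
  by (auto simp: sets_circle sets_restrict_space)

text \<open>Arc length is pushed forward to a finite Borel measure \<open>N\<close> on the plane,
  where outer regularity is known.\<close>

lemma circle_outer_regular:
  assumes B: "B \<in> sets borel" and d: "0 < d"
  obtains U where "open U" "B \<subseteq> U"
    "measure circle (U \<inter> sphere 0 1) < measure circle (B \<inter> sphere 0 1) + d"
proof -
  define N where "N = distr circle borel (\<lambda>z. z)"
  have id: "(\<lambda>z. z) \<in> borel_measurable circle"
    by (intro measurable_circle_continuous continuous_intros)
  have eN: "emeasure N A = ennreal (measure circle (A \<inter> sphere 0 1))" if "A \<in> sets borel" for A
    unfolding N_def using that
    by (subst emeasure_distr[OF id]) (simp_all add: circle.emeasure_eq_measure)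
  have "emeasure N B = (INF U \<in> {U. B \<subseteq> U \<and> open U}. emeasure N U)"
    by (rule outer_regular) (auto simp: N_def emeasure_distr[OF id] emeasure_circle_space B)
  moreover have "emeasure N B < emeasure N B + ennreal d"
    using d by (simp add: eN[OF B] ennreal_less_iff flip: ennreal_plus)
  ultimately have "(INF U \<in> {U. B \<subseteq> U \<and> open U}. emeasure N U) < emeasure N B + ennreal d"
    by (rule ord_eq_less_trans[OF sym])
  then obtain U where U: "B \<subseteq> U" "open U" "emeasure N U < emeasure N B + ennreal d"
    unfolding INF_less_iff by auto
  then have "measure circle (U \<inter> sphere 0 1) < measure circle (B \<inter> sphere 0 1) + d"
    using d B by (simp add: eN ennreal_less_iff flip: ennreal_plus)
  with U that show ?thesis by blast
qed

text \<open>K is the complement of an open V that covers the complement of E tightly. Then U - K is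
  the intersection of U and V, and since U and V together cover everything, its measure is the total
  excess of U and V over E and its complement.\<close>

lemma circle_regular:
  assumes E: "E \<in> sets circle" and d: "0 < d"
  obtains K U where "closed K" "open U" "K \<subseteq> E" "E \<subseteq> U"
    "measure circle ((U - K) \<inter> sphere 0 1) < d"
proof -
  let ?m = "\<lambda>A. measure circle (A \<inter> sphere 0 1)"
  note EB = sets_circle_borel[OF E]
  obtain U where U: "open U" "E \<subseteq> U" "?m U < ?m E + d / 2"
    using circle_outer_regular[OF EB, of "d / 2"] d by auto
  obtain V where V: "open V" "- E \<subseteq> V" "?m V < ?m (- E) + d / 2"
    using circle_outer_regular[of "- E" "d / 2"] d EB by auto
  have "?m (A \<union> B) = ?m A + ?m (B - A)" if "A \<in> sets borel" "B \<in> sets borel" for A B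
  proof -
    have "(A \<union> B) \<inter> sphere 0 1 = A \<inter> sphere 0 1 \<union> (B - A) \<inter> sphere 0 1" by auto
    then show ?thesis using that
      by (simp add: circle.finite_measure_Union sets_circleI sets.Diff disjoint_iff)
  qed
  note split = this
  have "?m (E \<union> - E) = ?m E + ?m (- E)"
    using split[of E "- E"] EB by (simp add: Diff_eq)
  moreover have "?m (V \<union> U) = ?m V + ?m (U - V)"
    using split[of V U] U V by auto
  moreover have "?m U = ?m (U - V) + ?m (U \<inter> V)"
  proof -
    have "U = (U - V) \<union> (U \<inter> V)" "(U \<inter> V) - (U - V) = U \<inter> V" by auto
    then show ?thesis using split[of "U - V" "U \<inter> V"] U V by auto
  qed
  moreover have "V \<union> U = E \<union> - E" using U V by auto
  ultimately have "?m (U \<inter> V) < d" using U(3) V(3) by simp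
  then show ?thesis
    using U V that[of "- V" U] by (auto simp: Diff_eq closed_Compl)
qed

text \<open>Dominated convergence for indicators. The sets need not be decreasing, which suits the
  exceptional sets of a pointwise convergent sequence.\<close>

lemma measure_circle_tendsto_0:
  assumes A: "\<And>i. A i \<in> sets circle" and ev: "\<And>z. z \<in> sphere 0 1 \<Longrightarrow> \<forall>\<^sub>F i in sequentially. z \<notin> A i"
  shows "(\<lambda>i. measure circle (A i)) \<longlonglongrightarrow> 0"
proof -
  have "(\<lambda>i. \<integral>z. indicat_real (A i) z \<partial>circle) \<longlonglongrightarrow> (\<integral>z. 0 \<partial>circle)"
  proof (rule integral_dominated_convergence[where w = "\<lambda>_. 1"])
    show "AE z in circle. (\<lambda>i. indicat_real (A i) z) \<longlonglongrightarrow> 0"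
    proof (rule AE_I2)
      fix z assume "z \<in> space circle"
      with ev have "\<forall>\<^sub>F i in sequentially. z \<notin> A i" by simp
      then have "\<forall>\<^sub>F i in sequentially. indicat_real (A i) z = 0" by eventually_elim simp
      then show "(\<lambda>i. indicat_real (A i) z) \<longlonglongrightarrow> 0" by (rule tendsto_eventually)
    qed
  qed (use A in \<open>auto simp: indicator_def\<close>)
  moreover have "A i \<inter> space circle = A i" for i using sets.sets_into_space[OF A] by blast
  ultimately show ?thesis by simp
qed

text \<open>In \<open>closure_wrt\<close> the tolerance ranges over the extended reals, while the
  approximation lemmas use real ones.\<close>

lemma ennreal_pos_obtain_real:
  assumes "(0::ennreal) < a"
  obtains e where "0 < e" "ennreal e < a"
proof -
  from assms obtain b where b: "0 < b" "b < a" using dense by blast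
  then obtain e where "b = ennreal e" "0 \<le> e" by (cases b) auto
  with b show ?thesis by (intro that[of e]) auto
qed

section \<open>Norms of vector-valued functions and smallness on small sets\<close>

context continuous_rot_sym_norm
begin

lemma vec_norm_triangle:
  fixes F :: "complex \<Rightarrow> 'x::real_normed_vector"
    and G :: "complex \<Rightarrow> 'y::{real_normed_vector,second_countable_topology}"
    and H :: "complex \<Rightarrow> 'z::{real_normed_vector,second_countable_topology}"
  assumes [measurable]: "G \<in> borel_measurable circle" "H \<in> borel_measurable circle"
    and "AE z in circle. norm (F z) \<le> norm (G z) + norm (H z)"
  shows "vec_norm \<alpha> F \<le> vec_norm \<alpha> G + vec_norm \<alpha> H"
  unfolding vec_norm_def
  by (rule ext_norm_triangle) (use assms(3) in \<open>simp_all add: norm_fun_def\<close>)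

lemma vec_norm_mono:
  assumes "AE z in circle. norm (F z) \<le> norm (G z)"
  shows "vec_norm \<alpha> F \<le> vec_norm \<alpha> G"
  unfolding vec_norm_def by (rule ext_norm_mono) (use assms in \<open>simp add: norm_fun_def\<close>)

lemma vec_norm_Linf:
  assumes "norm_fun F \<in> Linf"
  shows "vec_norm \<alpha> F = ennreal (\<alpha> (norm_fun F))"
  unfolding vec_norm_def by (rule ext_norm_Linf[OF assms])

lemma norm_fun_Linf:
  fixes F :: "complex \<Rightarrow> 'x::{real_normed_vector,second_countable_topology}"
  assumes [measurable]: "F \<in> borel_measurable circle" and "\<And>z. z \<in> sphere 0 1 \<Longrightarrow> norm (F z) \<le> C"
  shows "norm_fun F \<in> Linf"
  by (rule LinfI[of _ C]) (use assms in \<open>simp_all add: norm_fun_def\<close>)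

lemma vec_norm_le_const:
  fixes F :: "complex \<Rightarrow> 'x::{real_normed_vector,second_countable_topology}"
  assumes "F \<in> borel_measurable circle" "0 \<le> C" "\<And>z. z \<in> sphere 0 1 \<Longrightarrow> norm (F z) \<le> C"
  shows "vec_norm \<alpha> F \<le> ennreal C"
proof -
  have L: "norm_fun F \<in> Linf" using norm_fun_Linf assms by blast
  have "\<alpha> (norm_fun F) \<le> C"
    by (rule alpha_le_const[OF L]) (use assms in \<open>auto simp: norm_fun_def\<close>)
  then show ?thesis by (simp add: vec_norm_Linf[OF L] ennreal_leI)
qed

text \<open>The continuity axiom speaks of sets of positive measure only; for null sets the
  indicator vanishes almost everywhere and has norm 0.\<close>

lemma alpha_indicator_small:
  assumes e: "0 < e"
  obtains d where "0 < d" "\<And>E. E \<in> sets circle \<Longrightarrow> measure circle E < d \<Longrightarrow> \<alpha> (indicator E) < e"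
proof -
  obtain d where d: "0 < d" "\<And>E. E \<in> sets circle \<Longrightarrow> 0 < measure circle E \<Longrightarrow> measure circle E < d
      \<Longrightarrow> \<alpha> (indicator E) < e"
    using continuity e by blast
  show ?thesis
  proof (rule that[OF d(1)])
    fix E assume E: "E \<in> sets circle" "measure circle E < d"
    show "\<alpha> (indicator E) < e"
    proof (cases "measure circle E = 0")
      case True
      then have "E \<in> null_sets circle" using E by (auto simp: circle.emeasure_eq_measure)
      from AE_not_in[OF this] have "AE z in circle. (indicator E z :: complex) = 0"
        by eventually_elim simp
      then show ?thesis using zero_iff[OF Linf_indicator[OF E(1)]] e by simp
    next
      case False
      then have "0 < measure circle E" by (simp add: zero_less_measure_iff)
      with d(2) E show ?thesis by blast
    qed
  qed
qed

text \<open>Density is proved for the sum of \<open>\<alpha>\<close> and the \<open>L\<^sup>1\<close> norm, because it is needed to show that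
  \<open>\<alpha>\<close> dominates the \<open>L\<^sup>1\<close> norm.\<close>

definition joint_norm :: "(complex \<Rightarrow> 'x::real_normed_vector) \<Rightarrow> ennreal" where
  "joint_norm F = vec_norm \<alpha> F + (\<integral>\<^sup>+z. ennreal (norm (F z)) \<partial>circle)"

lemma joint_norm_mono:
  assumes "\<And>z. z \<in> sphere 0 1 \<Longrightarrow> norm (F z) \<le> norm (G z)"
  shows "joint_norm F \<le> joint_norm G"
  unfolding joint_norm_def
  by (intro add_mono vec_norm_mono nn_integral_mono) (use assms in \<open>auto intro: ennreal_leI\<close>)

lemma joint_norm_triangle:
  fixes F G H :: "complex \<Rightarrow> 'x::{real_normed_vector,second_countable_topology}"
  assumes [measurable]: "G \<in> borel_measurable circle" "H \<in> borel_measurable circle"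
    and le: "\<And>z. z \<in> sphere 0 1 \<Longrightarrow> norm (F z) \<le> norm (G z) + norm (H z)"
  shows "joint_norm F \<le> joint_norm G + joint_norm H"
proof -
  have "vec_norm \<alpha> F \<le> vec_norm \<alpha> G + vec_norm \<alpha> H"
    by (rule vec_norm_triangle) (use le in auto)
  moreover have "(\<integral>\<^sup>+z. ennreal (norm (F z)) \<partial>circle)
      \<le> (\<integral>\<^sup>+z. ennreal (norm (G z)) + ennreal (norm (H z)) \<partial>circle)"
    by (intro nn_integral_mono) (use le in \<open>auto simp flip: ennreal_plus intro!: ennreal_leI\<close>)
  moreover have "\<dots> = (\<integral>\<^sup>+z. ennreal (norm (G z)) \<partial>circle) + (\<integral>\<^sup>+z. ennreal (norm (H z)) \<partial>circle)"
    by (rule nn_integral_add) auto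
  ultimately show ?thesis
    unfolding joint_norm_def using add_mono by (fastforce simp: ac_simps)
qed

text \<open>Such an F is dominated by d + C times the indicator of A, which is small both in
  \<alpha> and in L1. A single d serves as measure threshold and as pointwise bound, which keeps
  applications short.\<close>

lemma joint_norm_small:
  assumes C: "0 \<le> C" and e: "0 < e"
  obtains d where "0 < d"
    "\<And>(F :: complex \<Rightarrow> 'x::{real_normed_vector,second_countable_topology}) A.
      F \<in> borel_measurable circle \<Longrightarrow> A \<in> sets circle \<Longrightarrow> measure circle A < d \<Longrightarrow>
      (\<And>z. z \<in> sphere 0 1 \<Longrightarrow> norm (F z) \<le> C) \<Longrightarrow>
      (\<And>z. z \<in> sphere 0 1 \<Longrightarrow> z \<notin> A \<Longrightarrow> norm (F z) \<le> d) \<Longrightarrow> joint_norm F < ennreal e"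
proof -
  \<comment> \<open>Chosen so that C * \<eta> < e/4; the summand 1 covers C = 0.\<close>
  define \<eta> where "\<eta> = e / (4 * (C + 1))"
  have \<eta>: "0 < \<eta>" using C e by (simp add: \<eta>_def)
  have C\<eta>: "C * \<eta> < e / 4" using C e by (simp add: \<eta>_def field_simps)
  obtain d where d: "0 < d" "\<And>E. E \<in> sets circle \<Longrightarrow> measure circle E < d \<Longrightarrow> \<alpha> (indicator E) < \<eta>"
    using alpha_indicator_small[OF \<eta>] by blast
  \<comment> \<open>The three entries control, in order, \<alpha> of the indicator, the measure of A
    in the L1 part, and the constant term in both parts.\<close>
  define d' where "d' = min d (min \<eta> (e / 4))"
  show ?thesis
  proof (rule that[of d'])
    show "0 < d'" using d \<eta> e by (simp add: d'_def)
    fix F :: "complex \<Rightarrow> 'x" and A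
    assume F[measurable]: "F \<in> borel_measurable circle" and A[measurable]: "A \<in> sets circle"
      and mA: "measure circle A < d'"
      and FC: "\<And>z. z \<in> sphere 0 1 \<Longrightarrow> norm (F z) \<le> C"
      and Fd: "\<And>z. z \<in> sphere 0 1 \<Longrightarrow> z \<notin> A \<Longrightarrow> norm (F z) \<le> d'"
    have le: "norm (F z) \<le> d' + C * indicator A z" if "z \<in> sphere 0 1" for z
      using FC[OF that] Fd[OF that] \<open>0 < d'\<close> by (auto simp: indicator_def)
    have L: "norm_fun F \<in> Linf" by (rule norm_fun_Linf[OF F FC])
    have "\<alpha> (norm_fun F) \<le> \<alpha> (\<lambda>z. of_real d' + of_real C * indicator A z)"
    proof (rule alpha_mono[OF L])
      show "(\<lambda>z. complex_of_real d' + of_real C * indicator A z) \<in> Linf"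
        by (intro Linf_add Linf_const Linf_scale Linf_indicator A)
      show "AE z in circle. cmod (norm_fun F z) \<le> cmod (complex_of_real d' + of_real C * indicator A z)"
      proof (rule AE_I2)
        fix z assume z: "z \<in> space circle"
        have "complex_of_real d' + of_real C * indicator A z = of_real (d' + C * indicator A z)"
          by (simp add: indicator_def)
        moreover have "norm (F z) \<le> \<bar>d' + C * indicator A z\<bar>" using le z by fastforce
        ultimately show "cmod (norm_fun F z) \<le> cmod (complex_of_real d' + of_real C * indicator A z)"
          by (simp only: norm_fun_def norm_of_real abs_norm_cancel)
      qed
    qed
    also have "\<dots> \<le> \<alpha> (\<lambda>z. of_real d') + \<alpha> (\<lambda>z. of_real C * indicator A z)"
      by (intro triangle Linf_const Linf_scale Linf_indicator A)
    also have "\<dots> = d' + C * \<alpha> (indicator A)"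
      using \<open>0 < d'\<close> C by (simp add: alpha_const scale[OF Linf_indicator[OF A]])
    also have "\<dots> \<le> d' + C * \<eta>"
      using d(2)[OF A] mA C by (intro add_left_mono mult_left_mono) (auto simp: d'_def)
    also have "\<dots> < e / 2" using C\<eta> by (simp add: d'_def)
    finally have 1: "\<alpha> (norm_fun F) < e / 2" .
    have int: "integrable circle (\<lambda>z. norm (F z))"
      by (rule circle.integrable_const_bound[of _ C]) (use FC in auto)
    have "(\<integral>z. norm (F z) \<partial>circle) \<le> (\<integral>z. d' + C * indicat_real A z \<partial>circle)"
      by (rule integral_mono[OF int]) (use le in \<open>auto simp: circle.emeasure_eq_measure\<close>)
    also have "\<dots> = d' + C * measure circle A"
      using sets.sets_into_space[OF A] by (simp add: circle.emeasure_eq_measure Int_absorb2)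
    also have "\<dots> \<le> d' + C * \<eta>"
      using mA C by (intro add_left_mono mult_left_mono) (auto simp: d'_def)
    also have "\<dots> < e / 2" using C\<eta> by (simp add: d'_def)
    finally have 2: "(\<integral>z. norm (F z) \<partial>circle) < e / 2" .
    have "joint_norm F = ennreal (\<alpha> (norm_fun F)) + ennreal (\<integral>z. norm (F z) \<partial>circle)"
      using nn_integral_eq_integral[OF int] by (simp add: joint_norm_def vec_norm_Linf[OF L])
    also have "\<dots> = ennreal (\<alpha> (norm_fun F) + (\<integral>z. norm (F z) \<partial>circle))"
      using nonneg[OF L] by (simp add: ennreal_plus)
    also have "\<dots> < ennreal e" using 1 2 e by (intro ennreal_lessI) auto
    finally show "joint_norm F < ennreal e" .
  qed
qed

end

section \<open>Density of trigonometric polynomials\<close>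

context continuous_rot_sym_norm
begin

definition trig_approximable :: "(complex \<Rightarrow> 'x::complex_banach) \<Rightarrow> bool" where
  "trig_approximable F \<longleftrightarrow>
     (\<forall>e>0. \<exists>P\<in>trig_polys (\<lambda>_. True). joint_norm (\<lambda>z. F z - P z) < ennreal e)"

lemma trig_approximable_cong:
  assumes "trig_approximable F" "\<And>z. z \<in> sphere 0 1 \<Longrightarrow> G z = F z"
  shows "trig_approximable G"
  unfolding trig_approximable_def
proof (intro allI impI)
  fix e :: real assume "0 < e"
  then obtain P where P: "P \<in> trig_polys (\<lambda>_. True)" "joint_norm (\<lambda>z. F z - P z) < ennreal e"
    using assms(1) unfolding trig_approximable_def by blast
  have "joint_norm (\<lambda>z. G z - P z) \<le> joint_norm (\<lambda>z. F z - P z)"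
    by (rule joint_norm_mono) (simp add: assms(2))
  with P show "\<exists>P\<in>trig_polys (\<lambda>_. True). joint_norm (\<lambda>z. G z - P z) < ennreal e"
    using le_less_trans by blast
qed

lemma trig_approximable_limit:
  fixes F :: "complex \<Rightarrow> 'x::{complex_banach,second_countable_topology}"
  assumes [measurable]: "F \<in> borel_measurable circle"
    and lim: "\<And>e. 0 < e \<Longrightarrow> \<exists>G\<in>borel_measurable circle. trig_approximable G
        \<and> joint_norm (\<lambda>z. F z - G z) < ennreal e"
  shows "trig_approximable F"
  unfolding trig_approximable_def
proof (intro allI impI)
  fix e :: real assume e: "0 < e"
  obtain G where [measurable]: "G \<in> borel_measurable circle"
    and G: "trig_approximable G" "joint_norm (\<lambda>z. F z - G z) < ennreal (e / 2)"
    using lim[of "e / 2"] e by auto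
  obtain P where P: "P \<in> trig_polys (\<lambda>_. True)" "joint_norm (\<lambda>z. G z - P z) < ennreal (e / 2)"
    using G(1) e unfolding trig_approximable_def by (meson half_gt_zero)
  note [measurable] = trig_polys_measurable[OF P(1)]
  have "joint_norm (\<lambda>z. F z - P z) \<le> joint_norm (\<lambda>z. F z - G z) + joint_norm (\<lambda>z. G z - P z)"
    by (rule joint_norm_triangle) (auto intro: norm_triangle_sub order_trans[OF _ norm_triangle_ineq])
  also have "\<dots> < ennreal (e / 2) + ennreal (e / 2)" by (rule add_strict_mono[OF G(2) P(2)])
  also have "\<dots> = ennreal e" using e by (simp flip: ennreal_plus)
  finally show "\<exists>P\<in>trig_polys (\<lambda>_. True). joint_norm (\<lambda>z. F z - P z) < ennreal e"
    using P(1) by blast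
qed

lemma trig_approximable_add:
  fixes F G :: "complex \<Rightarrow> 'x::{complex_banach,second_countable_topology}"
  assumes [measurable]: "F \<in> borel_measurable circle" "G \<in> borel_measurable circle"
    and "trig_approximable F" "trig_approximable G"
  shows "trig_approximable (\<lambda>z. F z + G z)"
  unfolding trig_approximable_def
proof (intro allI impI)
  fix e :: real assume e: "0 < e"
  obtain P where P: "P \<in> trig_polys (\<lambda>_. True)" "joint_norm (\<lambda>z. F z - P z) < ennreal (e / 2)"
    using assms(3) e unfolding trig_approximable_def by (meson half_gt_zero)
  obtain R where R: "R \<in> trig_polys (\<lambda>_. True)" "joint_norm (\<lambda>z. G z - R z) < ennreal (e / 2)"
    using assms(4) e unfolding trig_approximable_def by (meson half_gt_zero)
  note [measurable] = trig_polys_measurable[OF P(1)] trig_polys_measurable[OF R(1)]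
  have "joint_norm (\<lambda>z. F z + G z - (P z + R z))
      \<le> joint_norm (\<lambda>z. F z - P z) + joint_norm (\<lambda>z. G z - R z)"
    by (rule joint_norm_triangle) (auto simp: norm_diff_triangle_ineq)
  also have "\<dots> < ennreal (e / 2) + ennreal (e / 2)" by (rule add_strict_mono[OF P(2) R(2)])
  also have "\<dots> = ennreal e" using e by (simp flip: ennreal_plus)
  finally show "\<exists>P\<in>trig_polys (\<lambda>_. True). joint_norm (\<lambda>z. F z + G z - P z) < ennreal e"
    by (rule bexI[OF _ trig_polys_add[OF P(1) R(1)]])
qed

text \<open>The indicator is replaced by a Urysohn function g between K and U, then by a real
  polynomial h uniformly close to g on the circle, which there is a trigonometric polynomial. The
  first replacement changes values only on U - K, a set of small measure.\<close>

lemma trig_approximable_indicator: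
  fixes x :: "'x::{complex_banach,second_countable_topology}"
  assumes E: "E \<in> sets circle"
  shows "trig_approximable (\<lambda>z. indicat_real E z *\<^sub>R x)"
  unfolding trig_approximable_def
proof (intro allI impI)
  fix e :: real assume e: "0 < e"
  obtain d where d: "0 < d" and small:
    "\<And>(F :: complex \<Rightarrow> 'x) A.
      F \<in> borel_measurable circle \<Longrightarrow> A \<in> sets circle \<Longrightarrow> measure circle A < d \<Longrightarrow>
      (\<And>z. z \<in> sphere 0 1 \<Longrightarrow> norm (F z) \<le> 2 * norm x) \<Longrightarrow>
      (\<And>z. z \<in> sphere 0 1 \<Longrightarrow> z \<notin> A \<Longrightarrow> norm (F z) \<le> d) \<Longrightarrow> joint_norm F < ennreal e"
    \<comment> \<open>The factor 2 is 1 for indicator against g plus at most 1 for g against h; this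
      is why \<eta> below is capped at 1.\<close>
    using joint_norm_small[of "2 * norm x" e] e by (metis mult_nonneg_nonneg norm_ge_zero zero_le_numeral)
  obtain K U where KU: "closed K" "open U" "K \<subseteq> E" "E \<subseteq> U" "measure circle ((U - K) \<inter> sphere 0 1) < d"
    using circle_regular[OF E d] by blast
  have "closed (- U)" "K \<inter> - U = {}" using KU by auto
  then obtain g :: "complex \<Rightarrow> real" where g: "continuous_on UNIV g" "\<And>z. g z \<in> closed_segment 1 0"
    "\<And>z. z \<in> K \<Longrightarrow> g z = 1" "\<And>z. z \<in> - U \<Longrightarrow> g z = 0"
    using Urysohn[OF KU(1), of "- U" 1 0] by metis
  have g01: "0 \<le> g z" "g z \<le> 1" for z using g(2)[of z] by (auto simp: closed_segment_eq_real_ivl)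
  define \<eta> where "\<eta> = min 1 (d / (norm x + 1))"
  have nx: "0 < norm x + 1" by (simp add: add_nonneg_pos)
  then have \<eta>: "0 < \<eta>" "\<eta> \<le> 1" using d by (auto simp: \<eta>_def)
  have \<eta>d: "\<eta> * norm x \<le> d"
  proof -
    have "\<eta> * norm x \<le> d / (norm x + 1) * norm x" by (intro mult_right_mono) (auto simp: \<eta>_def)
    also have "\<dots> \<le> d" using d nx by (simp add: field_simps)
    finally show ?thesis .
  qed
  obtain h where h: "real_polynomial_function h" "\<And>z. z \<in> sphere 0 1 \<Longrightarrow> \<bar>g z - h z\<bar> < \<eta>"
    using Stone_Weierstrass_real_polynomial_function[of "sphere 0 1" g \<eta>] \<eta>(1)
      continuous_on_subset[OF g(1)] by auto
  obtain p where p: "p \<in> trig_polys (\<lambda>_. True)" "\<And>z. z \<in> sphere 0 1 \<Longrightarrow> p z = complex_of_real (h z)"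
    using real_polynomial_function_trig_poly[OF h(1)] by auto
  let ?P = "\<lambda>z. p z *\<^sub>C x"
  have P: "?P \<in> trig_polys (\<lambda>_. True)" by (rule trig_polys_scaleC_const[OF p(1)])
  note [measurable] = trig_polys_measurable[OF P]
  have eq: "norm (indicat_real E z *\<^sub>R x - ?P z) = \<bar>indicat_real E z - h z\<bar> * norm x"
    if "z \<in> sphere 0 1" for z
    using p(2)[OF that] by (simp flip: scaleR_scaleC scaleR_diff_left)
  have "joint_norm (\<lambda>z. indicat_real E z *\<^sub>R x - ?P z) < ennreal e"
  proof (rule small[of _ "(U - K) \<inter> sphere 0 1"])
    show "(\<lambda>z. indicat_real E z *\<^sub>R x - ?P z) \<in> borel_measurable circle"
      using E by measurable
    show "(U - K) \<inter> sphere 0 1 \<in> sets circle" using KU by (intro sets_circleI) auto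
    fix z :: complex assume z: "z \<in> sphere 0 1"
    have "\<bar>indicat_real E z - h z\<bar> \<le> 2"
      using h(2)[OF z] g01[of z] \<eta>(2) by (auto simp: indicator_def)
    then show "norm (indicat_real E z *\<^sub>R x - ?P z) \<le> 2 * norm x"
      unfolding eq[OF z] by (intro mult_right_mono) auto
    assume "z \<notin> (U - K) \<inter> sphere 0 1"
    then have "indicat_real E z = g z"
      using z KU(3,4) g(3)[of z] g(4)[of z] by (auto simp: indicator_def)
    then have "\<bar>indicat_real E z - h z\<bar> \<le> \<eta>" using h(2)[OF z] by simp
    then have "\<bar>indicat_real E z - h z\<bar> * norm x \<le> \<eta> * norm x" by (intro mult_right_mono) auto
    then show "norm (indicat_real E z *\<^sub>R x - ?P z) \<le> d" unfolding eq[OF z] using \<eta>d by simp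
  qed (rule KU(5))
  then show "\<exists>P\<in>trig_polys (\<lambda>_. True). joint_norm (\<lambda>z. indicat_real E z *\<^sub>R x - P z) < ennreal e"
    by (rule bexI[OF _ P])
qed

lemma trig_approximable_simple:
  fixes s :: "complex \<Rightarrow> 'x::{complex_banach,second_countable_topology}"
  assumes s: "simple_function circle s"
  shows "trig_approximable s"
proof -
  define E where "E y = s -` {y} \<inter> sphere 0 1" for y
  have E: "E y \<in> sets circle" for y
    using simple_functionD(2)[OF s, of "{y}"] by (simp add: E_def)
  have m: "(\<lambda>z. indicat_real (E y) z *\<^sub>R y) \<in> borel_measurable circle" for y
    using E by measurable
  have fin: "finite (s ` sphere 0 1)" using simple_functionD(1)[OF s] by simp
  \<comment> \<open>Generalized from the set of values of s to any finite Y, so that induction on Y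
    applies.\<close>
  have app: "trig_approximable (\<lambda>z. \<Sum>y\<in>Y. indicat_real (E y) z *\<^sub>R y)" if "finite Y" for Y
    using that
  proof (induction Y rule: finite_induct)
    case empty
    have "joint_norm (\<lambda>z. 0 - 0 :: 'x) = 0"
      using ext_norm_Linf[OF Linf_const[of 0]] alpha_const[of 0]
      by (simp add: joint_norm_def vec_norm_def norm_fun_def)
    then show ?case unfolding trig_approximable_def
      by (auto intro!: bexI[of _ "\<lambda>z. 0"] trig_polys_zero)
  next
    case (insert y Y)
    have "trig_approximable (\<lambda>z. indicat_real (E y) z *\<^sub>R y + (\<Sum>y\<in>Y. indicat_real (E y) z *\<^sub>R y))"
      by (intro trig_approximable_add trig_approximable_indicator borel_measurable_sum m E insert.IH)
    then show ?case by (simp only: sum.insert[OF insert.hyps])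
  qed
  show ?thesis
  proof (rule trig_approximable_cong[OF app[OF fin]])
    fix z :: complex assume z: "z \<in> sphere 0 1"
    have "(\<Sum>y\<in>s ` sphere 0 1. indicat_real (E y) z *\<^sub>R y) = (\<Sum>y\<in>s ` sphere 0 1. if y = s z then y else 0)"
      using z by (intro sum.cong refl) (auto simp: E_def indicator_def)
    also have "\<dots> = s z" using fin z by (simp add: sum.delta)
    finally show "s z = (\<Sum>y\<in>s ` sphere 0 1. indicat_real (E y) z *\<^sub>R y)" ..
  qed
qed

text \<open>Pointwise convergence of simple approximants gives convergence in measure, and the
  uniform bound turns this into joint norm convergence.\<close>

lemma trig_approximable_bounded:
  fixes F :: "complex \<Rightarrow> 'x::{complex_banach,second_countable_topology}"
  assumes F[measurable]: "F \<in> borel_measurable circle"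
    and bound: "\<And>z. z \<in> sphere 0 1 \<Longrightarrow> norm (F z) \<le> C"
  shows "trig_approximable F"
proof (rule trig_approximable_limit[OF F])
  fix e :: real assume e: "0 < e"
  have C: "0 \<le> C" using order_trans[OF norm_ge_zero bound[of 1]] by simp
  obtain s where s: "\<And>i. simple_function circle (s i)"
    and s': "\<forall>z\<in>space circle. (\<lambda>i. s i z) \<longlonglongrightarrow> F z"
      "\<forall>i. \<forall>z\<in>space circle. dist (s i z) 0 \<le> 2 * dist (F z) 0"
    using borel_measurable_implies_sequence_metric[OF F, of 0] by blast
  have lim: "(\<lambda>i. s i z) \<longlonglongrightarrow> F z" and sb: "norm (s i z) \<le> 2 * norm (F z)"
    if "z \<in> sphere 0 1" for i z
    using s' that by simp_all
  have [measurable]: "s i \<in> borel_measurable circle" for i by (rule borel_measurable_simple_function[OF s])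
  obtain d where d: "0 < d" and small:
    "\<And>(F :: complex \<Rightarrow> 'x) A.
      F \<in> borel_measurable circle \<Longrightarrow> A \<in> sets circle \<Longrightarrow> measure circle A < d \<Longrightarrow>
      (\<And>z. z \<in> sphere 0 1 \<Longrightarrow> norm (F z) \<le> 3 * C) \<Longrightarrow>
      (\<And>z. z \<in> sphere 0 1 \<Longrightarrow> z \<notin> A \<Longrightarrow> norm (F z) \<le> d) \<Longrightarrow> joint_norm F < ennreal e"
    \<comment> \<open>C from F itself and 2C from the simple functions, which satisfy |s_i| \<le>
      2|F|.\<close>
    using joint_norm_small[of "3 * C" e] e C by (metis mult_nonneg_nonneg zero_le_numeral)
  define A where "A i = {z \<in> space circle. d < norm (F z - s i z)}" for i
  have A[measurable]: "A i \<in> sets circle" for i unfolding A_def by measurable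
  have "(\<lambda>i. measure circle (A i)) \<longlonglongrightarrow> 0"
  proof (rule measure_circle_tendsto_0[OF A])
    fix z :: complex assume "z \<in> sphere 0 1"
    from tendstoD[OF lim[OF this] d] show "\<forall>\<^sub>F i in sequentially. z \<notin> A i"
      by eventually_elim (simp add: A_def dist_norm norm_minus_commute)
  qed
  then have "\<forall>\<^sub>F i in sequentially. measure circle (A i) < d"
    using d by (rule order_tendstoD)
  then obtain i where i: "measure circle (A i) < d" using eventually_happens by fastforce
  have "joint_norm (\<lambda>z. F z - s i z) < ennreal e"
  proof (rule small[OF _ A i])
    fix z :: complex assume z: "z \<in> sphere 0 1"
    show "norm (F z - s i z) \<le> 3 * C"
      using norm_triangle_ineq4[of "F z" "s i z"] bound[OF z] sb[OF z, of i] by simp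
    show "norm (F z - s i z) \<le> d" if "z \<notin> A i" using that z by (simp add: A_def)
  qed measurable
  then show "\<exists>G\<in>borel_measurable circle. trig_approximable G \<and> joint_norm (\<lambda>z. F z - G z) < ennreal e"
    using trig_approximable_simple[OF s] by (intro bexI[of _ "s i"]) auto
qed

text \<open>The joint norm pays off here: with b - P small in both senses, |\<integral>b| \<le>
  |\<integral>P| + e/2 by L1 and \<alpha>(P) \<le> \<alpha>(b) + e/2.\<close>

lemma cmod_integral_le_alpha:
  assumes b[measurable]: "b \<in> borel_measurable circle" and bound: "\<And>z. z \<in> sphere 0 1 \<Longrightarrow> cmod (b z) \<le> C"
  shows "cmod (\<integral>z. b z \<partial>circle) \<le> \<alpha> b"
proof (rule field_le_epsilon)
  fix e :: real assume e: "0 < e"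
  have bL: "b \<in> Linf" by (rule LinfI[OF b bound])
  obtain P where P: "P \<in> trig_polys (\<lambda>_. True)" and bP: "joint_norm (\<lambda>z. b z - P z) < ennreal (e / 2)"
    using trig_approximable_bounded[OF b bound] e unfolding trig_approximable_def by (meson half_gt_zero)
  note PL = Linf_trig_poly[OF P] and [measurable] = trig_polys_measurable[OF P]
  have intb: "integrable circle b"
    by (rule circle.integrable_const_bound[of _ C]) (use bound in auto)
  note int = intb trig_polys_integrable[OF P]
  have "\<alpha> (\<lambda>z. P z - b z) < e / 2"
  proof -
    have L: "(\<lambda>z. b z - P z) \<in> Linf" by (rule Linf_diff[OF bL PL])
    have "norm_fun (\<lambda>z. b z - P z) \<in> Linf" unfolding norm_fun_def by (rule Linf_cmod[OF L])
    then have "ennreal (\<alpha> (\<lambda>z. b z - P z)) = vec_norm \<alpha> (\<lambda>z. b z - P z)"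
      using modulus[OF L] by (simp add: vec_norm_Linf norm_fun_def)
    also have "\<dots> \<le> joint_norm (\<lambda>z. b z - P z)" by (simp add: joint_norm_def)
    also note bP
    finally have "\<alpha> (\<lambda>z. b z - P z) < e / 2" using nonneg[OF L] by (simp add: ennreal_less_iff)
    then show ?thesis using scale[OF L, of "-1"] by simp
  qed
  moreover have "\<alpha> P \<le> \<alpha> (\<lambda>z. P z - b z) + \<alpha> b"
    using triangle[OF Linf_diff[OF PL bL] bL] by simp
  moreover have "cmod (\<integral>z. P z \<partial>circle) \<le> \<alpha> P" by (rule cmod_integral_trig_poly_le[OF P])
  moreover have "(\<integral>z. cmod (b z - P z) \<partial>circle) < e / 2"
  proof -
    have "ennreal (\<integral>z. cmod (b z - P z) \<partial>circle) = (\<integral>\<^sup>+z. cmod (b z - P z) \<partial>circle)"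
      using int by (intro nn_integral_eq_integral[symmetric]) auto
    also have "\<dots> \<le> joint_norm (\<lambda>z. b z - P z)" by (simp add: joint_norm_def)
    also note bP
    finally show ?thesis by (simp add: ennreal_less_iff)
  qed
  moreover have "cmod (\<integral>z. b z \<partial>circle) \<le> cmod (\<integral>z. P z \<partial>circle) + (\<integral>z. cmod (b z - P z) \<partial>circle)"
  proof -
    have "(\<integral>z. b z \<partial>circle) = (\<integral>z. P z \<partial>circle) + (\<integral>z. b z - P z \<partial>circle)"
      using int by simp
    then show ?thesis
      using norm_triangle_ineq integral_norm_bound[of circle "\<lambda>z. b z - P z"]
      by (metis add_left_mono order_trans)
  qed
  ultimately show "cmod (\<integral>z. b z \<partial>circle) \<le> \<alpha> b + e" by simp
qed

text \<open>The truncations of |F| are bounded and lie below |F|; monotone convergence removes them.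
  The nonnegative integral is used since integrability of F is only a consequence.\<close>

lemma nn_integral_le_vec_norm:
  fixes F :: "complex \<Rightarrow> 'x::{real_normed_vector,second_countable_topology}"
  assumes [measurable]: "F \<in> borel_measurable circle"
  shows "(\<integral>\<^sup>+z. ennreal (norm (F z)) \<partial>circle) \<le> vec_norm \<alpha> F"
proof -
  define b where "b N z = min (norm (F z)) (real N)" for N z
  have [measurable]: "b N \<in> borel_measurable circle" for N unfolding b_def by measurable
  have b0: "0 \<le> b N z" "b N z \<le> real N" for N z by (auto simp: b_def)
  have "(\<integral>\<^sup>+z. ennreal (norm (F z)) \<partial>circle) = (\<integral>\<^sup>+z. (SUP N. ennreal (b N z)) \<partial>circle)"
  proof (rule nn_integral_cong)
    fix z
    show "ennreal (norm (F z)) = (SUP N. ennreal (b N z))"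
    proof (rule antisym)
      have "norm (F z) = b (nat \<lceil>norm (F z)\<rceil>) z" by (simp add: b_def min_def)
      then show "ennreal (norm (F z)) \<le> (SUP N. ennreal (b N z))"
        by (metis SUP_upper UNIV_I)
    qed (auto intro!: SUP_least ennreal_leI simp: b_def)
  qed
  also have "\<dots> = (SUP N. \<integral>\<^sup>+z. ennreal (b N z) \<partial>circle)"
    by (rule nn_integral_monotone_convergence_SUP)
       (auto simp: incseq_def le_fun_def b_def intro!: ennreal_leI)
  also have "\<dots> \<le> vec_norm \<alpha> F"
  proof (rule SUP_least)
    fix N
    have int: "integrable circle (b N)"
      by (rule circle.integrable_const_bound[of _ "real N"]) (use b0 in auto)
    have L: "(\<lambda>z. complex_of_real (b N z)) \<in> Linf"
      by (rule LinfI[of _ "real N"]) (use b0 in auto)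
    have "(\<integral>\<^sup>+z. ennreal (b N z) \<partial>circle) = ennreal (\<integral>z. b N z \<partial>circle)"
      using b0 by (intro nn_integral_eq_integral int) auto
    also have "(\<integral>z. b N z \<partial>circle) \<le> \<alpha> (\<lambda>z. complex_of_real (b N z))"
      using cmod_integral_le_alpha[of "\<lambda>z. complex_of_real (b N z)" "real N"] b0
      by (simp add: integral_complex_of_real)
    also have "ennreal \<dots> \<le> vec_norm \<alpha> F"
      unfolding vec_norm_def by (rule alpha_le_ext_norm[OF L]) (simp add: norm_fun_def b_def)
    finally show "(\<integral>\<^sup>+z. ennreal (b N z) \<partial>circle) \<le> vec_norm \<alpha> F" by (simp add: ennreal_leI)
  qed
  finally show ?thesis .
qed

end

section \<open>Convergence of Cesaro means and closed spans\<close>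

context continuous_rot_sym_norm
begin

lemma calL_vec_integrable:
  fixes F :: "complex \<Rightarrow> 'x::{complex_banach,second_countable_topology}"
  assumes "F \<in> calL_vec \<alpha>"
  shows "integrable circle F" "ennreal (\<integral>z. norm (F z) \<partial>circle) \<le> vec_norm \<alpha> F"
proof -
  have F: "F \<in> borel_measurable circle" "vec_norm \<alpha> F < \<infinity>"
    using assms by (auto simp: calL_vec_def)
  with nn_integral_le_vec_norm[OF F(1)] show int: "integrable circle F"
    by (intro integrableI_bounded) auto
  show "ennreal (\<integral>z. norm (F z) \<partial>circle) \<le> vec_norm \<alpha> F"
    using nn_integral_le_vec_norm[OF F(1)] nn_integral_eq_integral[of circle "\<lambda>z. norm (F z)"] int
    by simp
qed

lemma trig_polys_calL_vec:
  fixes P :: "complex \<Rightarrow> 'x::{complex_banach,second_countable_topology}"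
  assumes "P \<in> trig_polys Q"
  shows "P \<in> calL_vec \<alpha>"
  using trig_polys_measurable[OF assms] vec_norm_Linf[OF Linf_norm_fun_trig_poly[OF assms]]
  by (simp add: calL_vec_def)

lemma calL_vec_diff:
  fixes F G :: "complex \<Rightarrow> 'x::{complex_banach,second_countable_topology}"
  assumes "F \<in> calL_vec \<alpha>" "G \<in> calL_vec \<alpha>"
  shows "(\<lambda>z. F z - G z) \<in> calL_vec \<alpha>"
proof -
  have [measurable]: "F \<in> borel_measurable circle" "G \<in> borel_measurable circle"
    and fin: "vec_norm \<alpha> F < \<infinity>" "vec_norm \<alpha> G < \<infinity>"
    using assms by (auto simp: calL_vec_def)
  have "vec_norm \<alpha> (\<lambda>z. F z - G z) \<le> vec_norm \<alpha> F + vec_norm \<alpha> G"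
    by (rule vec_norm_triangle) (auto intro: norm_triangle_ineq4)
  also have "\<dots> < \<infinity>" using fin by simp
  finally show ?thesis by (simp add: calL_vec_def)
qed

text \<open>The hypothesis supplies a bounded h near |F|, which says nothing about directions in X.
  So F itself is truncated to 0 where |F| is large, and h serves only to show that the discarded
  part is small; the truncation is bounded and hence approximable.\<close>

lemma Lalpha_vec_trig_approx:
  fixes F :: "complex \<Rightarrow> 'x::{complex_banach,second_countable_topology}"
  assumes F: "F \<in> Lalpha_vec \<alpha>" and e: "0 < e"
  shows "\<exists>P\<in>trig_polys (\<lambda>_. True). vec_norm \<alpha> (\<lambda>z. F z - P z) < ennreal e"
proof -
  have [measurable]: "F \<in> borel_measurable circle" and L: "norm_fun F \<in> Lalpha \<alpha>"
    using F by (auto simp: Lalpha_vec_def)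
  have "0 < ennreal (e / 4)" using e by simp
  then obtain h where h: "h \<in> Linf" "ext_norm \<alpha> (\<lambda>z. norm_fun F z - h z) < ennreal (e / 4)"
    using L unfolding Lalpha_def closure_wrt_def by blast
  note [measurable] = Linf_measurable[OF h(1)]
  obtain C where C: "0 \<le> C" "AE z in circle. cmod (h z) \<le> C" using Linf_bound[OF h(1)] by blast
  define \<eta> where "\<eta> = e / (4 * (C + 1))"
  have \<eta>: "0 < \<eta>" "C * \<eta> < e / 4" using C e by (simp_all add: \<eta>_def field_simps)
  obtain d where d: "0 < d" "\<And>E. E \<in> sets circle \<Longrightarrow> measure circle E < d \<Longrightarrow> \<alpha> (indicator E) < \<eta>"
    using alpha_indicator_small[OF \<eta>(1)] by blast
  define A where "A N = {z \<in> space circle. real N < norm (F z)}" for N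
  have A[measurable]: "A N \<in> sets circle" for N unfolding A_def by measurable
  have "(\<lambda>N. measure circle (A N)) \<longlonglongrightarrow> 0"
  proof (rule measure_circle_tendsto_0[OF A])
    fix z :: complex
    obtain N where "norm (F z) \<le> real N" using real_arch_simple by blast
    then show "\<forall>\<^sub>F N in sequentially. z \<notin> A N"
      by (intro eventually_sequentiallyI[of N]) (auto simp: A_def)
  qed
  then have "\<forall>\<^sub>F N in sequentially. measure circle (A N) < d"
    using d(1) by (rule order_tendstoD)
  then obtain N where N: "measure circle (A N) < d" using eventually_happens by fastforce
  define G where "G z = (if z \<in> A N then 0 else F z)" for z
  have [measurable]: "G \<in> borel_measurable circle" unfolding G_def by measurable
  have "trig_approximable G"
    by (rule trig_approximable_bounded[of _ "real N"]) (auto simp: G_def A_def)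
  then obtain P where P: "P \<in> trig_polys (\<lambda>_. True)" "joint_norm (\<lambda>z. G z - P z) < ennreal (e / 2)"
    using e unfolding trig_approximable_def by (meson half_gt_zero)
  note [measurable] = trig_polys_measurable[OF P(1)]
  let ?I = "\<lambda>z. of_real C * indicator (A N) z :: complex"
  have IL: "?I \<in> Linf" by (intro Linf_scale Linf_indicator A)
  have I: "ext_norm \<alpha> ?I < ennreal (e / 4)"
  proof -
    have "C * \<alpha> (indicator (A N)) \<le> C * \<eta>"
      using d(2)[OF A N] C(1) by (intro mult_left_mono) auto
    then have "C * \<alpha> (indicator (A N)) < e / 4" using \<eta>(2) by simp
    then show ?thesis
      using C(1) e scale[OF Linf_indicator[OF A]] by (simp add: ext_norm_Linf[OF IL] ennreal_lessI)
  qed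
  \<comment> \<open>On the cut-off set F - G = F and |F| \<le> ||F| - h| + C; elsewhere the
    difference is 0.\<close>
  have "vec_norm \<alpha> (\<lambda>z. F z - G z) \<le> ext_norm \<alpha> (\<lambda>z. norm_fun F z - h z) + ext_norm \<alpha> ?I"
    unfolding vec_norm_def
  proof (rule ext_norm_triangle)
    show "AE z in circle. cmod (norm_fun (\<lambda>z. F z - G z) z) \<le> cmod (norm_fun F z - h z) + cmod (?I z)"
      using C(2)
    proof eventually_elim
      case (elim z)
      have "norm (F z) \<le> cmod (norm_fun F z - h z) + cmod (h z)"
        using norm_triangle_ineq[of "norm_fun F z - h z" "h z"] by (simp add: norm_fun_def)
      then show ?case using C(1) elim by (auto simp: G_def norm_fun_def norm_mult)
    qed
  qed (unfold norm_fun_def, measurable)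
  also have "\<dots> < ennreal (e / 4) + ennreal (e / 4)" by (rule add_strict_mono[OF h(2) I])
  finally have FG: "vec_norm \<alpha> (\<lambda>z. F z - G z) < ennreal (e / 4) + ennreal (e / 4)" .
  have GP: "vec_norm \<alpha> (\<lambda>z. G z - P z) < ennreal (e / 2)"
    using P(2) by (rule le_less_trans[rotated]) (simp add: joint_norm_def)
  have "vec_norm \<alpha> (\<lambda>z. F z - P z) \<le> vec_norm \<alpha> (\<lambda>z. F z - G z) + vec_norm \<alpha> (\<lambda>z. G z - P z)"
    by (rule vec_norm_triangle) (auto intro: norm_diff_triangle_le)
  also have "\<dots> < (ennreal (e / 4) + ennreal (e / 4)) + ennreal (e / 2)"
    by (rule add_strict_mono[OF FG GP])
  also have "\<dots> = ennreal e" using e by (simp flip: ennreal_plus)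
  finally show ?thesis using P(1) by blast
qed

text \<open>For the reverse inclusion, ||F| - |P|| \<le> |F - P| shows that the bounded functions
  |P| approximate |F|.\<close>

lemma Lalpha_vec_eq_closure:
  "(Lalpha_vec \<alpha> :: (complex \<Rightarrow> 'x::{complex_banach,second_countable_topology}) set)
     = closure_wrt (vec_norm \<alpha>) (calL_vec \<alpha>) (trig_polys (\<lambda>_. True))"
proof (intro equalityI subsetI)
  fix F :: "complex \<Rightarrow> 'x" assume F: "F \<in> Lalpha_vec \<alpha>"
  then have "F \<in> calL_vec \<alpha>"
    by (simp add: Lalpha_vec_def Lalpha_def closure_wrt_def calL_def calL_vec_def vec_norm_def)
  moreover have "\<exists>G\<in>trig_polys (\<lambda>_. True). vec_norm \<alpha> (\<lambda>z. F z - G z) < \<epsilon>" if "\<epsilon> > 0" for \<epsilon>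
  proof -
    obtain e where e: "0 < e" "ennreal e < \<epsilon>" using ennreal_pos_obtain_real[OF \<open>\<epsilon> > 0\<close>] by blast
    with Lalpha_vec_trig_approx[OF F e(1)] show ?thesis using less_trans by blast
  qed
  ultimately show "F \<in> closure_wrt (vec_norm \<alpha>) (calL_vec \<alpha>) (trig_polys (\<lambda>_. True))"
    by (simp add: closure_wrt_def)
next
  fix F :: "complex \<Rightarrow> 'x"
  assume F: "F \<in> closure_wrt (vec_norm \<alpha>) (calL_vec \<alpha>) (trig_polys (\<lambda>_. True))"
  then have [measurable]: "F \<in> borel_measurable circle" and fin: "vec_norm \<alpha> F < \<infinity>"
    by (auto simp: closure_wrt_def calL_vec_def)
  have "norm_fun F \<in> calL \<alpha>"
    using fin unfolding calL_def vec_norm_def norm_fun_def by simp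
  moreover have "\<exists>h\<in>Linf. ext_norm \<alpha> (\<lambda>z. norm_fun F z - h z) < \<epsilon>" if "\<epsilon> > 0" for \<epsilon>
  proof -
    obtain P where P: "P \<in> trig_polys (\<lambda>_. True)" "vec_norm \<alpha> (\<lambda>z. F z - P z) < \<epsilon>"
      using F \<open>\<epsilon> > 0\<close> unfolding closure_wrt_def by blast
    have "ext_norm \<alpha> (\<lambda>z. norm_fun F z - norm_fun P z) \<le> vec_norm \<alpha> (\<lambda>z. F z - P z)"
      unfolding vec_norm_def
      by (rule ext_norm_mono) (simp add: norm_fun_def norm_triangle_ineq3 flip: of_real_diff)
    also note P(2)
    finally show ?thesis using Linf_norm_fun_trig_poly[OF P(1)] by blast
  qed
  ultimately show "F \<in> Lalpha_vec \<alpha>"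
    by (simp add: Lalpha_vec_def Lalpha_def closure_wrt_def)
qed

text \<open>Stated for functions approximable by trigonometric polynomials rather than for
  \<open>Lalpha_vec\<close>, because it is later applied to F - P, whose approximability is
  immediate from that of F.\<close>

lemma vec_norm_cesaro_mean_le:
  fixes F :: "complex \<Rightarrow> 'x::{complex_banach,second_countable_topology}"
  assumes F: "F \<in> calL_vec \<alpha>"
    and approx: "\<And>e. 0 < e \<Longrightarrow> \<exists>P\<in>trig_polys (\<lambda>_. True). vec_norm \<alpha> (\<lambda>z. F z - P z) < ennreal e"
  shows "vec_norm \<alpha> (cesaro_mean n F) \<le> vec_norm \<alpha> F"
proof (rule ennreal_le_epsilon)
  fix e :: real assume e: "0 < e"
  \<comment> \<open>This cancels the factor 2n+1 of \<open>cesaro_mean_bound\<close>; P therefore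
    depends on n, which is fixed here.\<close>
  define \<eta> where "\<eta> = e / (2 * real (2 * n + 1))"
  have \<eta>: "0 < \<eta>" "real (2 * n + 1) * \<eta> = e / 2" "\<eta> \<le> e / 2" using e by (auto simp: \<eta>_def field_simps)
  obtain P where P: "P \<in> trig_polys (\<lambda>_. True)" "vec_norm \<alpha> (\<lambda>z. F z - P z) < ennreal \<eta>"
    using approx[OF \<eta>(1)] by blast
  let ?D = "\<lambda>z. F z - P z"
  have [measurable]: "F \<in> borel_measurable circle" "P \<in> borel_measurable circle"
    "cesaro_mean n G \<in> borel_measurable circle" for G :: "complex \<Rightarrow> 'x"
    using F trig_polys_measurable[OF P(1)]
      trig_polys_measurable[OF cesaro_mean_in_trig_polys[of "\<lambda>_. True" G n]]
    by (auto simp: calL_vec_def)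
  note D = calL_vec_diff[OF F trig_polys_calL_vec[OF P(1)]]
  have "ennreal (\<integral>z. norm (?D z) \<partial>circle) < ennreal \<eta>"
    using calL_vec_integrable(2)[OF D] P(2) by (rule le_less_trans)
  then have I: "(\<integral>z. norm (?D z) \<partial>circle) < \<eta>" by (simp add: ennreal_less_iff)
  have 1: "vec_norm \<alpha> (cesaro_mean n ?D) \<le> ennreal (e / 2)"
  proof (rule vec_norm_le_const)
    fix z :: complex assume z: "z \<in> sphere 0 1"
    have "norm (cesaro_mean n ?D z) \<le> real (2 * n + 1) * (\<integral>z. norm (?D z) \<partial>circle)"
      by (rule cesaro_mean_bound[OF calL_vec_integrable(1)[OF D] z])
    also have "\<dots> \<le> real (2 * n + 1) * \<eta>" using I by (intro mult_left_mono) auto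
    finally show "norm (cesaro_mean n ?D z) \<le> e / 2" unfolding \<eta>(2) .
  qed (use e in auto)
  have eq: "cesaro_mean n ?D z = cesaro_mean n F z - cesaro_mean n P z" for z
    by (rule cesaro_mean_diff[OF calL_vec_integrable(1)[OF F] trig_polys_integrable[OF P(1)]])
  have "vec_norm \<alpha> (cesaro_mean n F) \<le> vec_norm \<alpha> (cesaro_mean n P) + vec_norm \<alpha> (cesaro_mean n ?D)"
  proof (rule vec_norm_triangle, goal_cases)
    case 3
    show ?case unfolding eq by (simp add: norm_triangle_sub)
  qed measurable
  also have "vec_norm \<alpha> (cesaro_mean n P) \<le> vec_norm \<alpha> P"
    using alpha_cesaro_mean_le[OF P(1), of n]
      Linf_norm_fun_trig_poly[OF cesaro_mean_in_trig_polys[of "\<lambda>_. True" P n]]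
      Linf_norm_fun_trig_poly[OF P(1)]
    by (simp add: vec_norm_Linf ennreal_leI)
  also have "vec_norm \<alpha> P \<le> vec_norm \<alpha> F + vec_norm \<alpha> ?D"
  proof (rule vec_norm_triangle, goal_cases)
    case 3
    show ?case using norm_triangle_sub[of "P _" "F _"] by (simp add: norm_minus_commute)
  qed measurable
  also have "vec_norm \<alpha> ?D \<le> ennreal (e / 2)"
    using P(2) ennreal_leI[OF \<eta>(3)] by simp
  also note 1
  finally have "vec_norm \<alpha> (cesaro_mean n F) \<le> vec_norm \<alpha> F + ennreal (e / 2) + ennreal (e / 2)"
    by (simp add: add_mono)
  also have "\<dots> = vec_norm \<alpha> F + ennreal e" using e by (simp add: add.assoc flip: ennreal_plus)
  finally show "vec_norm \<alpha> (cesaro_mean n F) \<le> vec_norm \<alpha> F + ennreal e" .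
qed

text \<open>With D = F - P, the error is at most |D| + |\<sigma>_n D| + |P - \<sigma>_n P|. The
  contraction makes the second term as small as the first uniformly in n, and the third tends to 0
  uniformly on the circle.\<close>

lemma cesaro_mean_tendsto:
  fixes F :: "complex \<Rightarrow> 'x::{complex_banach,second_countable_topology}"
  assumes F: "F \<in> Lalpha_vec \<alpha>"
  shows "(\<lambda>n. vec_norm \<alpha> (\<lambda>z. F z - cesaro_mean n F z)) \<longlonglongrightarrow> 0"
proof (rule order_tendstoI)
  fix a :: ennreal assume "0 < a"
  then obtain e where e: "0 < e" "ennreal e < a" by (rule ennreal_pos_obtain_real)
  have FL: "F \<in> calL_vec \<alpha>" using F by (simp add: Lalpha_vec_eq_closure closure_wrt_def)
  obtain P where P: "P \<in> trig_polys (\<lambda>_. True)" "vec_norm \<alpha> (\<lambda>z. F z - P z) < ennreal (e / 3)"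
    using Lalpha_vec_trig_approx[OF F, of "e / 3"] e by auto
  let ?D = "\<lambda>z. F z - P z"
  have [measurable]: "F \<in> borel_measurable circle" "P \<in> borel_measurable circle"
    "cesaro_mean n G \<in> borel_measurable circle" for n and G :: "complex \<Rightarrow> 'x"
    using FL trig_polys_measurable[OF P(1)]
      trig_polys_measurable[OF cesaro_mean_in_trig_polys[of "\<lambda>_. True" G n]]
    by (auto simp: calL_vec_def)
  note D = calL_vec_diff[OF FL trig_polys_calL_vec[OF P(1)]]
  \<comment> \<open>Approximants of F - P are approximants of F minus P.\<close>
  have "\<exists>R\<in>trig_polys (\<lambda>_. True). vec_norm \<alpha> (\<lambda>z. ?D z - R z) < ennreal d" if "0 < d" for d
  proof -
    obtain R where R: "R \<in> trig_polys (\<lambda>_. True)" "vec_norm \<alpha> (\<lambda>z. F z - R z) < ennreal d"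
      using Lalpha_vec_trig_approx[OF F \<open>0 < d\<close>] by auto
    then show ?thesis by (intro bexI[OF _ trig_polys_diff[OF R(1) P(1)]]) simp
  qed
  from vec_norm_cesaro_mean_le[OF D this] have cD: "vec_norm \<alpha> (cesaro_mean n ?D) \<le> vec_norm \<alpha> ?D" for n .
  have eq: "cesaro_mean n ?D z = cesaro_mean n F z - cesaro_mean n P z" for n z
    by (rule cesaro_mean_diff[OF calL_vec_integrable(1)[OF FL] trig_polys_integrable[OF P(1)]])
  obtain C where C: "\<And>n z. z \<in> sphere 0 1 \<Longrightarrow> norm (P z - cesaro_mean n P z) \<le> C / real (n + 1)"
    using cesaro_mean_trig_poly_error[OF P(1)] by blast
  have "(\<lambda>n. C / real (n + 1)) \<longlonglongrightarrow> 0" by real_asymp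
  then have "\<forall>\<^sub>F n in sequentially. C / real (n + 1) < e / 3"
    using e by (intro order_tendstoD) auto
  then show "\<forall>\<^sub>F n in sequentially. vec_norm \<alpha> (\<lambda>z. F z - cesaro_mean n F z) < a"
  proof eventually_elim
    case (elim n)
    have 1: "vec_norm \<alpha> (\<lambda>z. P z - cesaro_mean n P z) \<le> ennreal (e / 3)"
      proof (rule vec_norm_le_const)
        show "norm (P z - cesaro_mean n P z) \<le> e / 3" if "z \<in> sphere 0 1" for z
          using C[OF that, of n] elim by (rule order_trans[OF _ less_imp_le])
      qed (use e in auto)
    have "vec_norm \<alpha> (\<lambda>z. F z - cesaro_mean n F z)
        \<le> vec_norm \<alpha> (\<lambda>z. F z - P z - cesaro_mean n ?D z) + vec_norm \<alpha> (\<lambda>z. P z - cesaro_mean n P z)"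
    proof (rule vec_norm_triangle, goal_cases)
      case 3
      have "F z - cesaro_mean n F z = (F z - P z - cesaro_mean n ?D z) + (P z - cesaro_mean n P z)" for z
        by (simp add: eq)
      then show ?case by (metis (mono_tags, lifting) AE_I2 norm_triangle_ineq)
    qed measurable
    also have "vec_norm \<alpha> (\<lambda>z. F z - P z - cesaro_mean n ?D z)
        \<le> vec_norm \<alpha> ?D + vec_norm \<alpha> (cesaro_mean n ?D)"
      by (rule vec_norm_triangle) (auto intro: norm_triangle_ineq4)
    also note cD
    also note 1
    finally have "vec_norm \<alpha> (\<lambda>z. F z - cesaro_mean n F z) \<le> vec_norm \<alpha> ?D + vec_norm \<alpha> ?D + ennreal (e / 3)"
      by (simp add: add_mono)
    also have "\<dots> \<le> ennreal (e / 3) + ennreal (e / 3) + ennreal (e / 3)"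
      by (intro add_mono less_imp_le[OF P(2)] order_refl)
    also have "\<dots> = ennreal e" using e by (simp flip: ennreal_plus)
    also note e(2)
    finally show ?case .
  qed
qed simp

text \<open>One inclusion holds because the Cesaro means of F have no negative frequencies. For the
  other, each Fourier coefficient is \<alpha>-continuous, being bounded by the L1 norm, so vanishing
  at k < 0 survives the limit.\<close>

lemma Halpha_vec_eq_closure:
  "(Halpha_vec \<alpha> :: (complex \<Rightarrow> 'x::{complex_banach,second_countable_topology}) set)
     = closure_wrt (vec_norm \<alpha>) (calL_vec \<alpha>) (trig_polys (\<lambda>n. n \<ge> 0))"
proof (intro equalityI subsetI)
  fix F :: "complex \<Rightarrow> 'x" assume "F \<in> Halpha_vec \<alpha>"
  then have F: "F \<in> Lalpha_vec \<alpha>" and neg: "\<And>n. n < 0 \<Longrightarrow> fourier_coeff F n = 0"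
    by (auto simp: Halpha_vec_def)
  have "\<exists>G\<in>trig_polys (\<lambda>n. n \<ge> 0). vec_norm \<alpha> (\<lambda>z. F z - G z) < \<epsilon>" if "\<epsilon> > 0" for \<epsilon>
  proof -
    from order_tendstoD(2)[OF cesaro_mean_tendsto[OF F] that]
    obtain n where "vec_norm \<alpha> (\<lambda>z. F z - cesaro_mean n F z) < \<epsilon>"
      using eventually_happens by fastforce
    moreover have "cesaro_mean n F \<in> trig_polys (\<lambda>n. n \<ge> 0)"
      by (rule cesaro_mean_in_trig_polys) (simp add: neg)
    ultimately show ?thesis by blast
  qed
  then show "F \<in> closure_wrt (vec_norm \<alpha>) (calL_vec \<alpha>) (trig_polys (\<lambda>n. n \<ge> 0))"
    using F by (simp add: closure_wrt_def Lalpha_vec_eq_closure)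
next
  fix F :: "complex \<Rightarrow> 'x"
  assume F: "F \<in> closure_wrt (vec_norm \<alpha>) (calL_vec \<alpha>) (trig_polys (\<lambda>n. n \<ge> 0))"
  then have FL: "F \<in> calL_vec \<alpha>"
    and approx: "\<And>\<epsilon>. \<epsilon> > 0 \<Longrightarrow> \<exists>P\<in>trig_polys (\<lambda>n. n \<ge> 0). vec_norm \<alpha> (\<lambda>z. F z - P z) < \<epsilon>"
    by (auto simp: closure_wrt_def)
  have "F \<in> Lalpha_vec \<alpha>"
    unfolding Lalpha_vec_eq_closure closure_wrt_def
    using FL approx trig_polys_mono[of _ "\<lambda>n. n \<ge> 0" "\<lambda>_. True"] by blast
  moreover have "fourier_coeff F k = 0" if "k < 0" for k
  proof -
    have "norm (fourier_coeff F k) \<le> e" if e: "0 < e" for e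
    proof -
      obtain P where P: "P \<in> trig_polys (\<lambda>n. n \<ge> 0)" "vec_norm \<alpha> (\<lambda>z. F z - P z) < ennreal e"
        using approx[of "ennreal e"] e by auto
      note D = calL_vec_integrable[OF calL_vec_diff[OF FL trig_polys_calL_vec[OF P(1)]]]
      have "fourier_coeff F k = fourier_coeff (\<lambda>z. F z - P z) k"
        using fourier_coeff_trig_poly[OF P(1), of k] \<open>k < 0\<close>
        by (simp add: fourier_coeff_diff calL_vec_integrable(1)[OF FL] trig_polys_integrable[OF P(1)])
      also have "norm \<dots> \<le> (\<integral>z. norm (F z - P z) \<partial>circle)"
        by (rule norm_fourier_coeff_le[OF D(1)])
      also have "\<dots> \<le> e"
        using le_less_trans[OF D(2) P(2)] by (simp add: ennreal_less_iff)
      finally show ?thesis .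
    qed
    then show ?thesis by (metis field_le_epsilon add_0 norm_le_zero_iff)
  qed
  ultimately show "F \<in> Halpha_vec \<alpha>" by (simp add: Halpha_vec_def)
qed

lemma fourier_sum_Halpha_vec:
  assumes F: "F \<in> Halpha_vec \<alpha>"
  shows "fourier_sum n F z = (\<Sum>k=0..n. (z ^ k) *\<^sub>C fourier_coeff F (int k))"
proof -
  have "fourier_sum n F z = (\<Sum>k\<in>int ` {0..n}. (z powi k) *\<^sub>C fourier_coeff F k)"
    unfolding fourier_sum_def
  proof (rule sum.mono_neutral_right)
    show "\<forall>k\<in>{- int n..int n} - int ` {0..n}. (z powi k) *\<^sub>C fourier_coeff F k = 0"
    proof
      fix k assume k: "k \<in> {- int n..int n} - int ` {0..n}"
      have "k < 0"
      proof (rule ccontr)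
        assume "\<not> k < 0"
        with k have "k = int (nat k)" "nat k \<in> {0..n}" by auto
        with k show False by blast
      qed
      then show "(z powi k) *\<^sub>C fourier_coeff F k = 0"
        using F by (simp add: Halpha_vec_def scaleC.zero_right)
    qed
  qed auto
  then show ?thesis by (simp add: sum.reindex)
qed

end

theorem proposition6p6:
  fixes \<alpha> :: "(complex \<Rightarrow> complex) \<Rightarrow> real"
  assumes "continuous_rot_sym_norm \<alpha>"
  shows
    "(\<forall>F \<in> (Lalpha_vec \<alpha> :: (complex \<Rightarrow> 'x::{complex_banach,second_countable_topology}) set).
        (\<lambda>n. vec_norm \<alpha> (\<lambda>z. F z - cesaro_mean n F z)) \<longlonglongrightarrow> 0) \<and>
     (Lalpha_vec \<alpha> :: (complex \<Rightarrow> 'x) set) =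
        closed_linear_span \<alpha> {(\<lambda>z. (z powi n) *\<^sub>C x) |(x :: 'x) (n :: int). True} \<and>
     (\<forall>F \<in> (Halpha_vec \<alpha> :: (complex \<Rightarrow> 'x) set). \<forall>n. \<forall>z \<in> sphere 0 1.
        fourier_sum n F z = (\<Sum>k=0..n. (z ^ k) *\<^sub>C fourier_coeff F (int k))) \<and>
     (Halpha_vec \<alpha> :: (complex \<Rightarrow> 'x) set) =
        closed_linear_span \<alpha> {(\<lambda>z. (z powi n) *\<^sub>C x) |(x :: 'x) (n :: int). n \<ge> 0}"
proof -
  interpret continuous_rot_sym_norm \<alpha> by (rule assms)
  show ?thesis
    \<comment> \<open>After unfolding, \<open>trig_polys\<close> is the same span as in
      \<open>closed_linear_span\<close>, so the two closure lemmas are the required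
      equalities.\<close>
    using cesaro_mean_tendsto fourier_sum_Halpha_vec Lalpha_vec_eq_closure Halpha_vec_eq_closure
    unfolding closed_linear_span_def trig_polys_def by blast
qed

end
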